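(* Let $X$ be a finite-dimensional Banach space and let $E$ be a direction set in $X$ of cardinality $2k$. Then $(\mathcal{R}'(E),d_H)$ and $(\mathcal{N}'(E),d)$ are complete metric spaces.
   Context: $\mathcal{N}(X)$ is the set of equivalent norms on $X$, and $B_p=\{x: p(x)\le1\}$. A direction set in $(X,\|\cdot\|)$ is a finite subset $E\subset S_X$ of the unit sphere with $E=-E$ and $\operatorname{conv}(E)$ having nonempty interior; choosing one representative from each antipodal pair, write $E=\{\pm x_1,\dots,\pm x_k\}$ (cardinality $2k$). $\operatorname{Dir}(E)=\{cx:c>0,x\in E\}$; $\operatorname{Ext}$ denotes the set of extreme points. For $\alpha=(\alpha_1,\dots,\alpha_k)\in\mathbb{R}^k_{>0}$, $\operatorname{conv}(\alpha E)=\operatorname{conv}\{\pm\alpha_1^{-1}x_1,\dots,\pm\alpha_k^{-1}x_k\}$ and $\rho(x;\alpha E)=\inf\{r>0:x\in r\operatorname{conv}(\alpha E)\}$. The multiindex $\alpha$ is $E$-admissible if for every $i$ and every $0<\varepsilon_i<\alpha_i$, with $\alpha'=(\alpha_1,\dots,\alpha_i-\varepsilon_i,\dots,\alpha_k)$, one has $\rho(\cdot;\alpha'E)\ne\rho(\cdot;\alpha E)$. $\mathcal{N}(E)=\{p\in\mathcal{N}(X):\operatorname{Ext}(B_p)\subset\operatorname{Dir}(E)\}$ and $\mathcal{R}(E)=\{\alpha\in\mathbb{R}^k_{>0}:\alpha\text{ is }E\text{-admissible}\}$. $\mathcal{N}'(E)$ and $\mathcal{R}'(E)$ are the quotients of $\mathcal{N}(E)$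 and $\mathcal{R}(E)$ by the relation $x\sim y\iff y=cx$ for some $c>0$; a bar denotes the class of an element. For $p,q\in\mathcal{N}(X)$, $d(\overline p,\overline q)=\log(u/l)$, where $u\ge l>0$ are the optimal constants with $l\,p\le q\le u\,p$ on $X$. On $\mathbb{R}^k_{>0}/\sim$ the Hilbert metric is $d_H(\overline\alpha,\overline\beta)=\log\big(\max_i\frac{\alpha_i}{\beta_i}\big/\min_i\frac{\alpha_i}{\beta_i}\big)$. *)

theory Defs
  imports "HOL-Analysis.Analysis"
begin

section \<open>Equivalent norms and direction sets\<close>

definition equivalent_norms :: "('a::real_normed_vector \<Rightarrow> real) set" where
  "equivalent_norms = {p.
     (\<forall>x. 0 \<le> p x) \<and> (\<forall>x. p x = 0 \<longleftrightarrow> x = 0) \<and>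
     (\<forall>c x. p (c *\<^sub>R x) = \<bar>c\<bar> * p x) \<and>
     (\<forall>x y. p (x + y) \<le> p x + p y) \<and>
     (\<exists>a>0. \<exists>b>0. \<forall>x. a * norm x \<le> p x \<and> p x \<le> b * norm x)}"

definition direction_set :: "'a::real_normed_vector set \<Rightarrow> bool" where
  "direction_set E \<longleftrightarrow>
     finite E \<and> E \<subseteq> sphere 0 1 \<and> E = uminus ` E \<and> interior (convex hull E) \<noteq> {}"

definition Dir :: "'a::real_vector set \<Rightarrow> 'a set" where
  "Dir E = {c *\<^sub>R x | c x. c > 0 \<and> x \<in> E}"

definition unit_ball :: "('a \<Rightarrow> real) \<Rightarrow> 'a set" where
  "unit_ball p = {x. p x \<le> 1}"

definition Ext :: "'a::real_vector set \<Rightarrow> 'a set" where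
  "Ext S = {x. x extreme_point_of S}"

definition norms_on :: "'a::real_normed_vector set \<Rightarrow> ('a \<Rightarrow> real) set" where
  "norms_on E = {p \<in> equivalent_norms. Ext (unit_ball p) \<subseteq> Dir E}"

section \<open>Admissible multiindices\<close>

text \<open>A direction set of cardinality \<open>2k\<close> is presented by representatives
  \<open>x :: 'k \<Rightarrow> 'a\<close> of its antipodal pairs, where \<open>'k\<close> is a finite type with \<open>k\<close> elements;
  multiindices are vectors in \<open>real ^ 'k\<close>.\<close>

definition scaled_hull :: "('k::finite \<Rightarrow> 'a::real_vector) \<Rightarrow> real ^ 'k \<Rightarrow> 'a set" where
  "scaled_hull x \<alpha> =
     convex hull (\<Union>i. {inverse (\<alpha> $ i) *\<^sub>R x i, - (inverse (\<alpha> $ i) *\<^sub>R x i)})"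

definition hull_gauge :: "('k::finite \<Rightarrow> 'a::real_vector) \<Rightarrow> real ^ 'k \<Rightarrow> 'a \<Rightarrow> real" where
  "hull_gauge x \<alpha> = (\<lambda>z. Inf {r. r > 0 \<and> z \<in> (\<lambda>y. r *\<^sub>R y) ` scaled_hull x \<alpha>})"

definition positive_multiindices :: "(real ^ 'k::finite) set" where
  "positive_multiindices = {\<alpha>. \<forall>i. \<alpha> $ i > 0}"

definition admissible :: "('k::finite \<Rightarrow> 'a::real_vector) \<Rightarrow> real ^ 'k \<Rightarrow> bool" where
  "admissible x \<alpha> \<longleftrightarrow>
     (\<forall>i \<epsilon>. 0 < \<epsilon> \<and> \<epsilon> < \<alpha> $ i \<longrightarrow>
        hull_gauge x (\<chi> j. if j = i then \<alpha> $ j - \<epsilon> else \<alpha> $ j) \<noteq> hull_gauge x \<alpha>)"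

definition admissible_multiindices ::
    "('k::finite \<Rightarrow> 'a::real_vector) \<Rightarrow> (real ^ 'k) set" where
  "admissible_multiindices x = {\<alpha> \<in> positive_multiindices. admissible x \<alpha>}"

section \<open>Quotients by positive scaling\<close>

text \<open>The relations are not restricted to a carrier. All sets to which they are applied are
  closed under multiplication by positive scalars, so a class is the same set whether taken in
  the smaller space or in the ambient one.\<close>

definition norm_scaling :: "(('a \<Rightarrow> real) \<times> ('a \<Rightarrow> real)) set" where
  "norm_scaling = {(p, q). \<exists>c>0. q = (\<lambda>x. c * p x)}"

definition index_scaling :: "((real ^ 'k::finite) \<times> (real ^ 'k)) set" where
  "index_scaling = {(\<alpha>, \<beta>). \<exists>c>0. \<beta> = c *\<^sub>R \<alpha>}"

definition norm_classes :: "'a::real_normed_vector set \<Rightarrow> ('a \<Rightarrow> real) set set" where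
  "norm_classes E = norms_on E // norm_scaling"

definition admissible_classes ::
    "('k::finite \<Rightarrow> 'a::real_vector) \<Rightarrow> (real ^ 'k) set set" where
  "admissible_classes x = admissible_multiindices x // index_scaling"

section \<open>The metrics\<close>

text \<open>Distance of classes computed from representatives. The functions \<open>f\<close> it is used with are
  invariant under the relation, so the choice is immaterial. Outside the quotient the value is
  \<open>0\<close>, because the locale \<open>Metric_space\<close> asks for nonnegativity and symmetry on the whole type.\<close>

definition class_dist ::
    "'b set \<Rightarrow> ('b \<times> 'b) set \<Rightarrow> ('b \<Rightarrow> 'b \<Rightarrow> real) \<Rightarrow> 'b set \<Rightarrow> 'b set \<Rightarrow> real" where
  "class_dist S r f P Q =
     (if P \<in> S // r \<and> Q \<in> S // r then f (SOME p. p \<in> P) (SOME q. q \<in> Q) else 0)"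

definition upper_const :: "('a \<Rightarrow> real) \<Rightarrow> ('a \<Rightarrow> real) \<Rightarrow> real" where
  "upper_const p q = Inf {u. u > 0 \<and> (\<forall>x. q x \<le> u * p x)}"

definition lower_const :: "('a \<Rightarrow> real) \<Rightarrow> ('a \<Rightarrow> real) \<Rightarrow> real" where
  "lower_const p q = Sup {l. l > 0 \<and> (\<forall>x. l * p x \<le> q x)}"

definition norm_metric ::
    "('a::real_normed_vector \<Rightarrow> real) set \<Rightarrow> ('a \<Rightarrow> real) set \<Rightarrow> real" where
  "norm_metric = class_dist equivalent_norms norm_scaling
     (\<lambda>p q. ln (upper_const p q / lower_const p q))"

definition hilbert_metric :: "(real ^ 'k::finite) set \<Rightarrow> (real ^ 'k) set \<Rightarrow> real" where
  "hilbert_metric = class_dist positive_multiindices index_scaling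
     (\<lambda>\<alpha> \<beta>. ln ((MAX i. \<alpha> $ i / \<beta> $ i) / (MIN i. \<alpha> $ i / \<beta> $ i)))"

end

theory Submission
  imports Defs
begin

text \<open>Write a vector as a combination \<open>\<Sum>\<^sub>j c\<^sub>j x\<^sub>j\<close> of the directions and call \<open>\<Sum>\<^sub>j \<bar>c\<^sub>j\<bar> \<alpha>\<^sub>j\<close> its
  cost. The gauge of the scaled hull of \<open>\<alpha>\<close> at a vector is the infimum of the costs of the
  combinations that represent it (\<open>hull_gauge_le\<close>, \<open>hull_gauge_ge\<close>). Lowering \<open>\<alpha>\<^sub>i\<close> leaves the
  gauge unchanged for some positive amount exactly if \<open>x\<^sub>i\<close> has a representation cheaper than
  \<open>\<alpha>\<^sub>i\<close>. Hence \<open>\<alpha>\<close> is admissible iff \<open>\<alpha>\<^sub>i \<le> \<Sum>\<^sub>j \<bar>c\<^sub>j\<bar> \<alpha>\<^sub>j\<close> for all representations of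
  all the \<open>x\<^sub>i\<close> (\<open>admissible_iff\<close>), a closed condition on \<open>\<alpha>\<close>.

  Completeness of the admissible classes follows. If each term of a Cauchy sequence is
  normalised to have one fixed coordinate equal to \<open>1\<close>, the Hilbert distance bounds the differences
  of the logarithms of all coordinates; these logarithms converge, the coordinates have
  positive limits, and the limit is admissible because the condition is closed
  (\<open>hilbert_complete\<close>).

  The norms are reduced to the multiindices by \<open>p \<mapsto> (p x\<^sub>i)\<^sub>i\<close>. If the extreme points of the
  unit ball of \<open>p\<close> lie in the given directions, Minkowski's theorem shows that the ball
  is the scaled hull of the values \<open>p x\<^sub>i\<close>, so every vector has a representation on which the
  triangle inequality is an equality (\<open>norms_on_combination\<close>). An inequality \<open>q \<le> u p\<close> can
  therefore be tested on the directions, and the distance of two such norms is the Hilbert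
  distance of their values (\<open>norm_distance_eq_hilbert\<close>). Conversely the gauge of an admissible
  \<open>\<alpha>\<close> is such a norm with the values \<open>\<alpha>\<^sub>i\<close> (\<open>hull_gauge_norms_on\<close>, \<open>hull_gauge_direction\<close>).
  Limits of multiindices thus give limits of norms.

  That both distances are metrics on the classes is a property of best constants in
  \<open>l p \<le> q \<le> u p\<close> for nonnegative functions on any set, treated in the locale
  \<open>projective_distance\<close>.\<close>

section \<open>Projective distances on quotients by positive scaling\<close>

text \<open>Norms are functions on the space and multiindices are functions on the index type, and
  on both the distance is \<open>ln (u / l)\<close> for the best constants with \<open>l p \<le> q \<le> u p\<close>. Treating the
  pair of constants as a relation rather than through \<open>Inf\<close>, \<open>Sup\<close>, \<open>Max\<close> or \<open>Min\<close> lets one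
  argument serve both, and reduces the comparison of the two distances to uniqueness of
  the constants.\<close>

definition optimal_ratio_bounds :: "('i \<Rightarrow> real) \<Rightarrow> ('i \<Rightarrow> real) \<Rightarrow> real \<Rightarrow> real \<Rightarrow> bool" where
  "optimal_ratio_bounds p q l u \<longleftrightarrow>
     (\<forall>z. 0 \<le> p z) \<and> 0 < l \<and> (\<forall>z. l * p z \<le> q z) \<and> (\<forall>z. q z \<le> u * p z) \<and>
     (\<forall>l'. (\<forall>z. l' * p z \<le> q z) \<longrightarrow> l' \<le> l) \<and> (\<forall>u'. (\<forall>z. q z \<le> u' * p z) \<longrightarrow> u \<le> u')"

lemma optimal_ratio_boundsI:
  assumes "\<And>z. 0 \<le> p z" "0 < l" "\<And>z. l * p z \<le> q z" "\<And>z. q z \<le> u * p z"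
    and "\<And>l'. (\<And>z. l' * p z \<le> q z) \<Longrightarrow> l' \<le> l" "\<And>u'. (\<And>z. q z \<le> u' * p z) \<Longrightarrow> u \<le> u'"
  shows "optimal_ratio_bounds p q l u"
  using assms unfolding optimal_ratio_bounds_def by blast

lemma optimal_ratio_boundsD:
  assumes "optimal_ratio_bounds p q l u"
  shows "0 \<le> p z" "0 < l" "l * p z \<le> q z" "q z \<le> u * p z"
    and "(\<And>z. l' * p z \<le> q z) \<Longrightarrow> l' \<le> l" "(\<And>z. q z \<le> u' * p z) \<Longrightarrow> u \<le> u'"
  using assms unfolding optimal_ratio_bounds_def by blast+

lemma optimal_ratio_bounds_unique:
  assumes "optimal_ratio_bounds p q l u" "optimal_ratio_bounds p q l' u'"
  shows "l = l'" "u = u'"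
  using assms unfolding optimal_ratio_bounds_def by (meson order_antisym)+

text \<open>If \<open>p\<close> vanished identically, every constant would be a lower bound, so none could be
  optimal.\<close>

lemma optimal_ratio_bounds_pos:
  assumes "optimal_ratio_bounds p q l u"
  obtains z where "0 < p z"
proof (rule ccontr)
  assume "\<not> thesis"
  then have "p z = 0" for z
    using that[of z] optimal_ratio_boundsD(1)[OF assms, of z] by linarith
  then have "l + 1 \<le> l"
    using optimal_ratio_boundsD(3)[OF assms] by (intro optimal_ratio_boundsD(5)[OF assms]) auto
  then show False
    by simp
qed

lemma optimal_ratio_bounds_le:
  assumes "optimal_ratio_bounds p q l u"
  shows "l \<le> u"
proof -
  obtain z where z: "0 < p z"
    using optimal_ratio_bounds_pos[OF assms] .
  have "l * p z \<le> u * p z"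
    using optimal_ratio_boundsD(3,4)[OF assms] order_trans by blast
  with z show ?thesis
    by simp
qed

lemma optimal_ratio_bounds_swap:
  assumes "optimal_ratio_bounds p q l u"
  shows "optimal_ratio_bounds q p (1 / u) (1 / l)"
proof -
  note D = optimal_ratio_boundsD[OF assms]
  have u: "0 < u"
    using optimal_ratio_bounds_le[OF assms] D(2) by linarith
  show ?thesis
  proof (rule optimal_ratio_boundsI)
    show "0 \<le> q z" for z
      using D(1,2,3) by (meson less_imp_le mult_nonneg_nonneg order_trans)
    show "0 < 1 / u" "1 / u * q z \<le> p z" "p z \<le> 1 / l * q z" for z
      using u D(2) D(3)[of z] D(4)[of z] by (simp_all add: field_simps)
    show "l' \<le> 1 / u" if "\<And>z. l' * q z \<le> p z" for l'
    proof (cases "0 < l'")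
      case True
      have "u \<le> 1 / l'"
        using that True by (intro D(6)) (simp add: field_simps)
      with True u show ?thesis
        by (simp add: field_simps)
    qed (use u in \<open>auto intro: order_trans[of _ 0]\<close>)
    show "1 / l \<le> u'" if *: "\<And>z. p z \<le> u' * q z" for u'
    proof -
      obtain z where z: "0 < p z"
        using optimal_ratio_bounds_pos[OF assms] .
      have "0 < q z"
        using z D(2) D(3)[of z] by (smt (verit) mult_pos_pos)
      then have u': "0 < u'"
        using z *[of z] by (smt (verit) mult_nonpos_nonneg)
      have "1 / u' \<le> l"
        using * u' by (intro D(5)) (simp add: field_simps)
      with u' D(2) show ?thesis
        by (simp add: field_simps)
    qed
  qed
qed

lemma optimal_ratio_bounds_trans:
  assumes pq: "optimal_ratio_bounds p q l u" and qr: "optimal_ratio_bounds q r l' u'"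
    and pr: "optimal_ratio_bounds p r L U"
  shows "l * l' \<le> L" "U \<le> u * u'"
proof -
  note pq = optimal_ratio_boundsD[OF pq] optimal_ratio_bounds_le[OF pq]
  note qr = optimal_ratio_boundsD[OF qr] optimal_ratio_bounds_le[OF qr]
  show "l * l' \<le> L"
  proof (rule optimal_ratio_boundsD(5)[OF pr])
    fix z
    have "l' * (l * p z) \<le> l' * q z"
      using qr(2) pq(3) by (intro mult_left_mono) auto
    with qr(3)[of z] show "l * l' * p z \<le> r z"
      by (simp add: algebra_simps)
  qed
  show "U \<le> u * u'"
  proof (rule optimal_ratio_boundsD(6)[OF pr])
    fix z
    have "u' * q z \<le> u' * (u * p z)"
      using qr(2,7) pq(4) by (intro mult_left_mono) auto
    with qr(4)[of z] show "r z \<le> u * u' * p z"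
      by (simp add: algebra_simps)
  qed
qed

locale projective_distance =
  fixes S :: "'b set" and ev :: "'b \<Rightarrow> 'i \<Rightarrow> real" and r :: "('b \<times> 'b) set"
    and f :: "'b \<Rightarrow> 'b \<Rightarrow> real"
  assumes scaling: "r = {(p, q). \<exists>c>0. ev q = (\<lambda>z. c * ev p z)}"
    and closed: "p \<in> S \<Longrightarrow> (p, q) \<in> r \<Longrightarrow> q \<in> S"
    and distance: "p \<in> S \<Longrightarrow> q \<in> S \<Longrightarrow>
          \<exists>l u. optimal_ratio_bounds (ev p) (ev q) l u \<and> f p q = ln (u / l)"
begin

lemma equiv_scaling: "equiv UNIV r"
proof (rule equivI)
  show "refl_on UNIV r"
    unfolding refl_on_def scaling by (auto intro!: exI[of _ 1])
  show "sym r"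
  proof (rule symI)
    fix p q assume "(p, q) \<in> r"
    then obtain c where "c > 0" "ev q = (\<lambda>z. c * ev p z)"
      unfolding scaling by blast
    then show "(q, p) \<in> r"
      unfolding scaling by (auto simp: fun_eq_iff intro!: exI[of _ "inverse c"])
  qed
  show "trans r"
  proof (rule transI)
    fix p q s assume "(p, q) \<in> r" "(q, s) \<in> r"
    then obtain c d where "c > 0" "ev q = (\<lambda>z. c * ev p z)" "d > 0" "ev s = (\<lambda>z. d * ev q z)"
      unfolding scaling by blast
    then show "(p, s) \<in> r"
      unfolding scaling by (auto intro!: exI[of _ "d * c"])
  qed
qed auto

lemma distance_commute:
  assumes "p \<in> S" "q \<in> S"
  shows "f p q = f q p"
proof -
  obtain l u where lu: "optimal_ratio_bounds (ev p) (ev q) l u" "f p q = ln (u / l)"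
    using distance[OF assms] by blast
  obtain l' u' where lu': "optimal_ratio_bounds (ev q) (ev p) l' u'" "f q p = ln (u' / l')"
    using distance[OF assms(2,1)] by blast
  have "l' = 1 / u" "u' = 1 / l"
    using optimal_ratio_bounds_unique[OF lu'(1) optimal_ratio_bounds_swap[OF lu(1)]] .
  with lu lu' show ?thesis
    by (simp add: field_simps)
qed

lemma distance_nonneg:
  assumes "p \<in> S" "q \<in> S"
  shows "0 \<le> f p q"
proof -
  obtain l u where lu: "optimal_ratio_bounds (ev p) (ev q) l u" "f p q = ln (u / l)"
    using distance[OF assms] by blast
  then show ?thesis
    using optimal_ratio_boundsD(2)[OF lu(1)] optimal_ratio_bounds_le[OF lu(1)] by simp
qed

lemma distance_triangle:
  assumes "p \<in> S" "q \<in> S" "s \<in> S"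
  shows "f p s \<le> f p q + f q s"
proof -
  obtain l u where pq: "optimal_ratio_bounds (ev p) (ev q) l u" "f p q = ln (u / l)"
    using distance assms by blast
  obtain l' u' where qs: "optimal_ratio_bounds (ev q) (ev s) l' u'" "f q s = ln (u' / l')"
    using distance assms by blast
  obtain L U where ps: "optimal_ratio_bounds (ev p) (ev s) L U" "f p s = ln (U / L)"
    using distance assms by blast
  have pos: "0 < l" "0 < u" "0 < l'" "0 < u'" "0 < L" "0 < U"
    using pq(1) qs(1) ps(1) optimal_ratio_boundsD(2) optimal_ratio_bounds_le by (metis order_less_le_trans)+
  have "U / L \<le> (u * u') / (l * l')"
    using optimal_ratio_bounds_trans[OF pq(1) qs(1) ps(1)] pos by (intro frac_le) auto
  also have "\<dots> = (u / l) * (u' / l')"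
    by simp
  finally have "ln (U / L) \<le> ln ((u / l) * (u' / l'))"
    using pos by (intro ln_mono) auto
  also have "\<dots> = ln (u / l) + ln (u' / l')"
    using pos by (intro ln_mult_pos) auto
  finally show ?thesis
    using pq qs ps by simp
qed

lemma distance_eq_0_iff:
  assumes "p \<in> S" "q \<in> S"
  shows "f p q = 0 \<longleftrightarrow> (p, q) \<in> r"
proof -
  obtain l u where lu: "optimal_ratio_bounds (ev p) (ev q) l u" "f p q = ln (u / l)"
    using distance[OF assms] by blast
  note D = optimal_ratio_boundsD[OF lu(1)]
  have le: "l \<le> u"
    using optimal_ratio_bounds_le[OF lu(1)] .
  have "f p q = 0 \<longleftrightarrow> l = u"
    using lu(2) D(2) le by auto
  also have "\<dots> \<longleftrightarrow> (p, q) \<in> r"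
  proof
    assume "l = u"
    then have "ev q = (\<lambda>z. l * ev p z)"
      using D(3,4) by (metis order_antisym)
    with D(2) show "(p, q) \<in> r"
      unfolding scaling by blast
  next
    assume "(p, q) \<in> r"
    then obtain c where "ev q = (\<lambda>z. c * ev p z)"
      unfolding scaling by blast
    then have "c \<le> l" "u \<le> c"
      by (auto intro: D(5,6))
    with le show "l = u"
      by simp
  qed
  finally show ?thesis .
qed

text \<open>Representatives of one class are at distance \<open>0\<close>, so the triangle inequality makes the
  distance independent of their choice.\<close>

lemma distance_congruent:
  assumes "p \<in> S" "q \<in> S" "(p, p') \<in> r" "(q, q') \<in> r"
  shows "f p' q' = f p q"
proof -
  have S': "p' \<in> S" "q' \<in> S"
    using assms closed by blast+
  have 0: "f p p' = 0" "f p' p = 0" "f q q' = 0" "f q' q = 0"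
    using assms S' distance_eq_0_iff distance_commute by metis+
  show ?thesis
    using distance_triangle[of p' p q'] distance_triangle[of p q q']
      distance_triangle[of p p' q] distance_triangle[of p' q' q] assms S' 0
    by linarith
qed

lemma class_dist_eq:
  assumes "p \<in> S" "q \<in> S"
  shows "class_dist S r f (r `` {p}) (r `` {q}) = f p q"
proof -
  have self: "s \<in> r `` {s}" for s
    using equiv_class_self[OF equiv_scaling UNIV_I] .
  have "(p, SOME s. s \<in> r `` {p}) \<in> r" "(q, SOME s. s \<in> r `` {q}) \<in> r"
    using someI[of "\<lambda>s. s \<in> r `` {p}", OF self] someI[of "\<lambda>s. s \<in> r `` {q}", OF self] by auto
  then show ?thesis
    using assms by (simp add: class_dist_def quotientI distance_congruent)
qed

theorem Metric_space_classes:
  assumes "T \<subseteq> S"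
  shows "Metric_space (T // r) (class_dist S r f)"
proof (rule Metric_space.subspace)
  show "T // r \<subseteq> S // r"
    using assms by (auto simp: quotient_def)
  show "Metric_space (S // r) (class_dist S r f)"
  proof
    fix P Q
    have "0 \<le> class_dist S r f P Q \<and> class_dist S r f P Q = class_dist S r f Q P"
    proof (cases "P \<in> S // r \<and> Q \<in> S // r")
      case True
      then obtain p q where "p \<in> S" "q \<in> S" "P = r `` {p}" "Q = r `` {q}"
        by (auto elim!: quotientE)
      then show ?thesis
        by (simp add: class_dist_eq distance_nonneg distance_commute)
    qed (auto simp: class_dist_def)
    then show "0 \<le> class_dist S r f P Q" "class_dist S r f P Q = class_dist S r f Q P"
      by auto
  next
    fix P Q assume "P \<in> S // r" "Q \<in> S // r"
    then obtain p q where pq: "p \<in> S" "q \<in> S" "P = r `` {p}" "Q = r `` {q}"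
      by (auto elim!: quotientE)
    then show "class_dist S r f P Q = 0 \<longleftrightarrow> P = Q"
      using equiv_scaling by (simp add: class_dist_eq distance_eq_0_iff eq_equiv_class_iff)
  next
    fix P Q R assume "P \<in> S // r" "Q \<in> S // r" "R \<in> S // r"
    then obtain p q s where "p \<in> S" "q \<in> S" "s \<in> S" "P = r `` {p}" "Q = r `` {q}" "R = r `` {s}"
      by (auto elim!: quotientE)
    then show "class_dist S r f P R \<le> class_dist S r f P Q + class_dist S r f Q R"
      by (simp add: class_dist_eq distance_triangle)
  qed
qed

theorem mcomplete_classes:
  assumes T: "T \<subseteq> S"
    and complete: "\<And>s. (\<And>n. s n \<in> T) \<Longrightarrow>
        (\<And>\<epsilon>. \<epsilon> > 0 \<Longrightarrow> \<exists>N. \<forall>m\<ge>N. \<forall>n\<ge>N. f (s m) (s n) < \<epsilon>) \<Longrightarrow>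
        \<exists>t\<in>T. (\<lambda>n. f (s n) t) \<longlonglongrightarrow> 0"
  shows "Metric_space.mcomplete (T // r) (class_dist S r f)"
proof -
  interpret Metric_space "T // r" "class_dist S r f"
    by (rule Metric_space_classes[OF T])
  show ?thesis
    unfolding mcomplete_def
  proof (intro allI impI)
    fix \<sigma> assume \<sigma>: "MCauchy \<sigma>"
    then have "range \<sigma> \<subseteq> T // r"
      by (simp add: MCauchy_def)
    then have "\<forall>n. \<exists>p\<in>T. \<sigma> n = r `` {p}"
      unfolding quotient_def by blast
    then obtain s where s: "\<And>n. s n \<in> T" "\<And>n. \<sigma> n = r `` {s n}"
      by metis
    have sS: "s n \<in> S" for n
      using s(1) T by blast
    have cauchy: "\<exists>N. \<forall>m\<ge>N. \<forall>n\<ge>N. f (s m) (s n) < \<epsilon>" if "\<epsilon> > 0" for \<epsilon>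
    proof -
      have "\<forall>\<epsilon>>0. \<exists>N. \<forall>m n. N \<le> m \<longrightarrow> N \<le> n \<longrightarrow> class_dist S r f (\<sigma> m) (\<sigma> n) < \<epsilon>"
        using \<sigma> by (simp add: MCauchy_def)
      with that obtain N where "\<forall>m n. N \<le> m \<longrightarrow> N \<le> n \<longrightarrow> class_dist S r f (\<sigma> m) (\<sigma> n) < \<epsilon>"
        by presburger
      then show ?thesis
        by (auto simp: s(2) class_dist_eq[OF sS sS])
    qed
    obtain t where t: "t \<in> T" "(\<lambda>n. f (s n) t) \<longlonglongrightarrow> 0"
      using complete[OF s(1) cauchy] by blast
    have "limitin mtopology \<sigma> (r `` {t}) sequentially"
      unfolding limitin_metric
    proof (intro conjI allI impI)
      show "r `` {t} \<in> T // r"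
        using t(1) by (rule quotientI)
      fix \<epsilon> :: real assume "\<epsilon> > 0"
      then have "\<forall>\<^sub>F n in sequentially. f (s n) t < \<epsilon>"
        using order_tendstoD(2)[OF t(2)] by blast
      moreover have "t \<in> S"
        using t(1) T by blast
      ultimately show "\<forall>\<^sub>F n in sequentially. \<sigma> n \<in> T // r \<and> class_dist S r f (\<sigma> n) (r `` {t}) < \<epsilon>"
        using s sS by (simp add: quotientI class_dist_eq)
    qed
    then show "\<exists>x. limitin mtopology \<sigma> x sequentially" ..
  qed
qed

text \<open>Representatives that agree with value \<open>1\<close> at a common index have \<open>l \<le> 1 \<le> u\<close>, so after
  this normalisation a sequence that is Cauchy for the projective distance has Cauchy logarithms
  at every index.\<close>

lemma log_diff_le_distance:
  assumes "p \<in> S" "q \<in> S" and one: "ev p z\<^sub>0 = 1" "ev q z\<^sub>0 = 1" and pos: "0 < ev p z" "0 < ev q z"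
  shows "\<bar>ln (ev p z) - ln (ev q z)\<bar> \<le> f p q"
proof -
  obtain l u where lu: "optimal_ratio_bounds (ev p) (ev q) l u" "f p q = ln (u / l)"
    using distance[OF assms(1,2)] by blast
  note D = optimal_ratio_boundsD[OF lu(1)]
  have l: "0 < l" "l \<le> 1" and u: "1 \<le> u"
    using D(2) D(3)[of z\<^sub>0] D(4)[of z\<^sub>0] one by auto
  have "ln (l * ev p z) \<le> ln (ev q z)" "ln (ev q z) \<le> ln (u * ev p z)"
    using D(3,4) l u pos by (auto intro!: ln_mono mult_pos_pos)
  then have "ln l + ln (ev p z) \<le> ln (ev q z)" "ln (ev q z) \<le> ln u + ln (ev p z)"
    using l u pos by (simp_all add: ln_mult_pos)
  moreover have "ln l \<le> 0" "0 \<le> ln u" "f p q = ln u - ln l"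
    using l u lu(2) by (auto simp: ln_div)
  ultimately show ?thesis
    by linarith
qed

lemma distance_le_log_diff:
  assumes "p \<in> S" "q \<in> S" and pos: "\<And>z. 0 < ev p z" "\<And>z. 0 < ev q z"
    and diff: "\<And>z. \<bar>ln (ev p z) - ln (ev q z)\<bar> \<le> e"
  shows "f p q \<le> 2 * e"
proof -
  obtain l u where lu: "optimal_ratio_bounds (ev p) (ev q) l u" "f p q = ln (u / l)"
    using distance[OF assms(1,2)] by blast
  note D = optimal_ratio_boundsD[OF lu(1)]
  have "ln (ev q z) \<le> e + ln (ev p z)" "- e + ln (ev p z) \<le> ln (ev q z)" for z
    using diff[of z] by linarith+
  then have "exp (ln (ev q z)) \<le> exp (e + ln (ev p z))" "exp (- e + ln (ev p z)) \<le> exp (ln (ev q z))" for z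
    by (simp_all only: exp_le_cancel_iff)
  then have "ev q z \<le> exp e * ev p z" "exp (- e) * ev p z \<le> ev q z" for z
    using pos by (simp_all only: exp_add exp_ln)
  then have le: "u \<le> exp e" "exp (- e) \<le> l"
    by (auto intro: D(5,6))
  have pos: "0 < l" "0 < u"
    using D(2) optimal_ratio_bounds_le[OF lu(1)] by auto
  have "ln u \<le> ln (exp e)" "ln (exp (- e)) \<le> ln l"
    using le pos by (intro ln_mono; simp)+
  then show ?thesis
    using lu(2) pos by (simp add: ln_div)
qed

end

section \<open>The two projective distances\<close>

lemma equivalent_normsD:
  assumes "p \<in> equivalent_norms"
  shows "0 \<le> p z" "p z = 0 \<longleftrightarrow> z = 0" "p (c *\<^sub>R z) = \<bar>c\<bar> * p z" "p (z + w) \<le> p z + p w"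
    and "\<exists>a>0. \<exists>b>0. \<forall>z. a * norm z \<le> p z \<and> p z \<le> b * norm z"
  using assms unfolding equivalent_norms_def by blast+

lemma equivalent_norms_pos:
  assumes "p \<in> equivalent_norms" "z \<noteq> 0"
  shows "0 < p z"
  using equivalent_normsD(1,2)[OF assms(1), of z] assms(2) by linarith

lemma equivalent_norms_minus:
  assumes "p \<in> equivalent_norms"
  shows "p (- z) = p z"
  using equivalent_normsD(3)[OF assms, of "-1" z] by simp

lemma equivalent_norms_zero:
  assumes "p \<in> equivalent_norms"
  shows "p 0 = 0"
  using equivalent_normsD(2)[OF assms] by simp

lemma equivalent_norms_dominated:
  assumes p: "p \<in> equivalent_norms" and q: "q \<in> equivalent_norms"
  obtains u where "0 < u" "\<And>z. q z \<le> u * p z"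
proof -
  obtain a where a: "0 < a" "\<And>z. a * norm z \<le> p z"
    using equivalent_normsD(5)[OF p] by blast
  obtain b where b: "0 < b" "\<And>z. q z \<le> b * norm z"
    using equivalent_normsD(5)[OF q] by blast
  have "q z \<le> (b / a) * p z" for z
  proof -
    have "b * (a * norm z) \<le> b * p z"
      using a b(1) by (intro mult_left_mono) auto
    then have "b * norm z \<le> (b / a) * p z"
      using a(1) by (simp add: field_simps)
    with b(2)[of z] show ?thesis
      by linarith
  qed
  with a b show ?thesis
    by (intro that[of "b / a"]) auto
qed

lemma optimal_ratio_bounds_norms:
  fixes p q :: "'a::real_normed_vector \<Rightarrow> real"
  assumes p: "p \<in> equivalent_norms" and q: "q \<in> equivalent_norms" and z\<^sub>0: "(z\<^sub>0 :: 'a) \<noteq> 0"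
  shows "optimal_ratio_bounds p q (lower_const p q) (upper_const p q)"
proof -
  let ?U = "{u. u > 0 \<and> (\<forall>x. q x \<le> u * p x)}" and ?L = "{l. l > 0 \<and> (\<forall>x. l * p x \<le> q x)}"
  note pD = equivalent_normsD[OF p] and qD = equivalent_normsD[OF q]
  have z\<^sub>0_pos: "0 < p z\<^sub>0" "0 < q z\<^sub>0"
    using equivalent_norms_pos p q z\<^sub>0 by blast+
  obtain u\<^sub>1 where u\<^sub>1: "u\<^sub>1 \<in> ?U"
    using equivalent_norms_dominated[OF p q] by blast
  obtain u\<^sub>2 where u\<^sub>2: "0 < u\<^sub>2" "\<And>z. p z \<le> u\<^sub>2 * q z"
    using equivalent_norms_dominated[OF q p] by blast
  then have l\<^sub>1: "inverse u\<^sub>2 \<in> ?L"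
    by (simp add: field_simps)
  have nonempty: "?U \<noteq> {}" "?L \<noteq> {}"
    using u\<^sub>1 l\<^sub>1 by blast+
  have bddU: "bdd_below ?U"
    by (auto intro!: bdd_belowI[of _ 0])
  have bddL: "bdd_above ?L"
  proof (rule bdd_aboveI[of _ "q z\<^sub>0 / p z\<^sub>0"])
    fix l assume "l \<in> ?L"
    then show "l \<le> q z\<^sub>0 / p z\<^sub>0"
      using z\<^sub>0_pos by (simp add: field_simps)
  qed
  show ?thesis
  proof (rule optimal_ratio_boundsI)
    show "0 \<le> p z" for z
      by (rule pD)
    have "inverse u\<^sub>2 \<le> lower_const p q"
      unfolding lower_const_def using l\<^sub>1 bddL by (rule cSup_upper)
    moreover have "0 < inverse u\<^sub>2"
      using u\<^sub>2(1) by simp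
    ultimately show pos: "0 < lower_const p q"
      by linarith
    show "lower_const p q * p z \<le> q z" for z
    proof (cases "z = 0")
      case False
      then have "0 < p z"
        using equivalent_norms_pos p by blast
      moreover from this have "lower_const p q \<le> q z / p z"
        unfolding lower_const_def
        by (intro cSup_least[OF nonempty(2)]) (auto simp: field_simps)
      ultimately show ?thesis
        by (simp add: field_simps)
    qed (simp add: equivalent_norms_zero[OF p] equivalent_norms_zero[OF q])
    show "q z \<le> upper_const p q * p z" for z
    proof (cases "z = 0")
      case False
      then have "0 < p z"
        using equivalent_norms_pos p by blast
      moreover from this have "q z / p z \<le> upper_const p q"
        unfolding upper_const_def
        by (intro cInf_greatest[OF nonempty(1)]) (auto simp: field_simps)
      ultimately show ?thesis
        by (simp add: field_simps)
    qed (simp add: equivalent_norms_zero[OF p] equivalent_norms_zero[OF q])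
    show "l' \<le> lower_const p q" if "\<And>z. l' * p z \<le> q z" for l'
    proof (cases "0 < l'")
      case True
      then show ?thesis
        unfolding lower_const_def using that bddL by (intro cSup_upper) auto
    qed (use pos in linarith)
    show "upper_const p q \<le> u'" if *: "\<And>z. q z \<le> u' * p z" for u'
    proof -
      have "0 < u' * p z\<^sub>0"
        using *[of z\<^sub>0] z\<^sub>0_pos by linarith
      then have "0 < u'"
        using z\<^sub>0_pos by (simp add: zero_less_mult_iff)
      then show ?thesis
        unfolding upper_const_def using * bddU by (intro cInf_lower) auto
    qed
  qed
qed

lemma equivalent_norms_scale:
  assumes p: "p \<in> equivalent_norms" and c: "0 < c"
  shows "(\<lambda>z. c * p z) \<in> equivalent_norms"
proof -
  note D = equivalent_normsD[OF p]
  obtain a b where ab: "0 < a" "0 < b" "\<And>z. a * norm z \<le> p z" "\<And>z. p z \<le> b * norm z"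
    using D(5) by blast
  have "c * p (z + w) \<le> c * p z + c * p w" for z w
    using mult_left_mono[OF D(4)[of z w], of c] c by (simp add: algebra_simps)
  moreover have "\<exists>a>0. \<exists>b>0. \<forall>z. a * norm z \<le> c * p z \<and> c * p z \<le> b * norm z"
  proof (intro exI conjI allI)
    show "0 < c * a" "0 < c * b"
      using c ab by auto
    show "c * a * norm z \<le> c * p z" "c * p z \<le> c * b * norm z" for z
      using mult_left_mono[OF ab(3)[of z], of c] mult_left_mono[OF ab(4)[of z], of c] c
      by (simp_all add: algebra_simps)
  qed
  ultimately show ?thesis
    using c D(1,2,3) unfolding equivalent_norms_def by auto
qed

lemma projective_distance_norms:
  assumes "(z\<^sub>0 :: 'a::real_normed_vector) \<noteq> 0"
  shows "projective_distance (equivalent_norms :: ('a \<Rightarrow> real) set) (\<lambda>p. p) norm_scaling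
           (\<lambda>p q. ln (upper_const p q / lower_const p q))"
proof
  show "norm_scaling = {(p :: 'a \<Rightarrow> real, q). \<exists>c>0. q = (\<lambda>z. c * p z)}"
    by (simp add: norm_scaling_def)
  show "q \<in> equivalent_norms" if "p \<in> equivalent_norms" "(p, q) \<in> norm_scaling" for p q :: "'a \<Rightarrow> real"
    using that equivalent_norms_scale by (auto simp: norm_scaling_def)
  show "\<exists>l u. optimal_ratio_bounds p q l u \<and> ln (upper_const p q / lower_const p q) = ln (u / l)"
    if "p \<in> equivalent_norms" "q \<in> equivalent_norms" for p q :: "'a \<Rightarrow> real"
    using optimal_ratio_bounds_norms[OF that assms] by blast
qed

text \<open>The Hilbert metric is built from the ratios \<open>\<alpha>\<^sub>i / \<beta>\<^sub>i\<close>, while \<open>d\<close> bounds its second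
  argument by its first; exchanging the roles replaces the pair \<open>(l, u)\<close> by
  \<open>(1 / u, 1 / l)\<close>, so \<open>u / l\<close> is the same for both orders.\<close>

lemma optimal_ratio_bounds_multiindices:
  assumes "\<alpha> \<in> positive_multiindices" "\<beta> \<in> positive_multiindices"
  shows "optimal_ratio_bounds (($) \<beta>) (($) \<alpha>) (MIN i. \<alpha> $ i / \<beta> $ i) (MAX i. \<alpha> $ i / \<beta> $ i)"
proof (rule optimal_ratio_boundsI)
  have pos: "0 < \<alpha> $ i" "0 < \<beta> $ i" for i
    using assms by (auto simp: positive_multiindices_def)
  show "0 \<le> \<beta> $ i" for i
    using pos less_imp_le by blast
  show "0 < (MIN i. \<alpha> $ i / \<beta> $ i)"
    using pos by (subst Min_gr_iff) auto
  show "(MIN i. \<alpha> $ i / \<beta> $ i) * \<beta> $ i \<le> \<alpha> $ i" for i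
  proof -
    have "(MIN i. \<alpha> $ i / \<beta> $ i) \<le> \<alpha> $ i / \<beta> $ i"
      by (intro Min_le) auto
    with pos[of i] show ?thesis
      by (simp add: field_simps)
  qed
  show "\<alpha> $ i \<le> (MAX i. \<alpha> $ i / \<beta> $ i) * \<beta> $ i" for i
  proof -
    have "\<alpha> $ i / \<beta> $ i \<le> (MAX i. \<alpha> $ i / \<beta> $ i)"
      by (intro Max_ge) auto
    with pos[of i] show ?thesis
      by (simp add: field_simps)
  qed
  show "l' \<le> (MIN i. \<alpha> $ i / \<beta> $ i)" if "\<And>i. l' * \<beta> $ i \<le> \<alpha> $ i" for l'
    using that pos by (subst Min_ge_iff) (auto simp: field_simps)
  show "(MAX i. \<alpha> $ i / \<beta> $ i) \<le> u'" if "\<And>i. \<alpha> $ i \<le> u' * \<beta> $ i" for u'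
    using that pos by (subst Max_le_iff) (auto simp: field_simps)
qed

lemma projective_distance_multiindices:
  "projective_distance positive_multiindices ($) (index_scaling :: ((real ^ 'k::finite) \<times> _) set)
     (\<lambda>\<alpha> \<beta>. ln ((MAX i. \<alpha> $ i / \<beta> $ i) / (MIN i. \<alpha> $ i / \<beta> $ i)))"
proof
  show "index_scaling = {(\<alpha> :: real ^ 'k, \<beta>). \<exists>c>0. ($) \<beta> = (\<lambda>i. c * \<alpha> $ i)}"
    by (auto simp: index_scaling_def vec_eq_iff fun_eq_iff)
  show "\<beta> \<in> positive_multiindices" if "\<alpha> \<in> positive_multiindices" "(\<alpha>, \<beta>) \<in> index_scaling"
    for \<alpha> \<beta> :: "real ^ 'k"
    using that by (auto simp: index_scaling_def positive_multiindices_def)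
  show "\<exists>l u. optimal_ratio_bounds (($) \<alpha>) (($) \<beta>) l u \<and>
          ln ((MAX i. \<alpha> $ i / \<beta> $ i) / (MIN i. \<alpha> $ i / \<beta> $ i)) = ln (u / l)"
    if "\<alpha> \<in> positive_multiindices" "\<beta> \<in> positive_multiindices" for \<alpha> \<beta> :: "real ^ 'k"
    using optimal_ratio_bounds_swap[OF optimal_ratio_bounds_multiindices[OF that]]
    by (intro exI[of _ "1 / (MAX i. \<alpha> $ i / \<beta> $ i)"] exI[of _ "1 / (MIN i. \<alpha> $ i / \<beta> $ i)"])
      (simp add: field_simps)
qed

section \<open>Scaled hulls and their gauges\<close>

text \<open>The property \<open>spanning\<close> replaces the interior point of a direction set: every vector is a
  combination of directions whose coefficients are controlled by its norm. It is what makes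
  the gauges below finite and the closed balls compact.\<close>

locale spanning_directions =
  fixes x :: "'k::finite \<Rightarrow> 'a::real_normed_vector" and K :: real
  assumes unit: "norm (x i) = 1"
    and K_pos: "0 < K"
    and spanning: "\<exists>c. z = (\<Sum>j\<in>UNIV. c j *\<^sub>R x j) \<and> (\<Sum>j\<in>UNIV. \<bar>c j\<bar>) \<le> K * norm z"

lemma positive_multiindicesD: "\<alpha> \<in> positive_multiindices \<Longrightarrow> 0 < \<alpha> $ i"
  by (simp add: positive_multiindices_def)

text \<open>The combination with coefficients \<open>c\<close> costs \<open>\<Sum>\<^sub>j \<bar>c\<^sub>j\<bar> \<alpha>\<^sub>j\<close>, because the vertex available in
  direction \<open>x\<^sub>j\<close> is \<open>x\<^sub>j / \<alpha>\<^sub>j\<close>.\<close>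

lemma scaled_hull_eq:
  fixes x :: "'k::finite \<Rightarrow> 'a::real_vector"
  assumes \<alpha>: "\<alpha> \<in> positive_multiindices"
  shows "scaled_hull x \<alpha> =
    {(\<Sum>j\<in>UNIV. c j *\<^sub>R x j) | c. (\<Sum>j\<in>UNIV. \<bar>c j\<bar> * \<alpha> $ j) \<le> 1}" (is "_ = ?R")
proof
  note pos = positive_multiindicesD[OF \<alpha>]
  show "scaled_hull x \<alpha> \<subseteq> ?R"
    unfolding scaled_hull_def
  proof (rule hull_minimal)
    have "s *\<^sub>R inverse (\<alpha> $ i) *\<^sub>R x i \<in> ?R" if "\<bar>s\<bar> = 1" for i and s :: real
    proof -
      let ?c = "\<lambda>j. if j = i then s * inverse (\<alpha> $ i) else 0"
      have "(\<Sum>j\<in>UNIV. ?c j *\<^sub>R x j) = s *\<^sub>R inverse (\<alpha> $ i) *\<^sub>R x i"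
        by (simp add: if_distrib[of "\<lambda>c. c *\<^sub>R _"] sum.delta cong: if_cong)
      moreover have "(\<Sum>j\<in>UNIV. \<bar>?c j\<bar> * \<alpha> $ j) = (\<Sum>j\<in>UNIV. if j = i then 1 else 0)"
        using pos[of i] that by (intro sum.cong) (auto simp: abs_mult)
      then have "(\<Sum>j\<in>UNIV. \<bar>?c j\<bar> * \<alpha> $ j) \<le> 1"
        by simp
      ultimately show ?thesis
        by (intro CollectI exI[of _ ?c]) simp
    qed
    from this[of 1] this[of "-1"]
    show "(\<Union>i. {inverse (\<alpha> $ i) *\<^sub>R x i, - (inverse (\<alpha> $ i) *\<^sub>R x i)}) \<subseteq> ?R"
      by auto
    show "convex ?R"
    proof (rule convexI)
      fix y w and a b :: real
      assume "y \<in> ?R" "w \<in> ?R" and ab: "0 \<le> a" "0 \<le> b" "a + b = 1"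
      then obtain c d where y: "y = (\<Sum>j\<in>UNIV. c j *\<^sub>R x j)" "(\<Sum>j\<in>UNIV. \<bar>c j\<bar> * \<alpha> $ j) \<le> 1"
        and w: "w = (\<Sum>j\<in>UNIV. d j *\<^sub>R x j)" "(\<Sum>j\<in>UNIV. \<bar>d j\<bar> * \<alpha> $ j) \<le> 1"
        by blast
      have "(\<Sum>j\<in>UNIV. \<bar>a * c j + b * d j\<bar> * \<alpha> $ j)
          \<le> (\<Sum>j\<in>UNIV. a * (\<bar>c j\<bar> * \<alpha> $ j) + b * (\<bar>d j\<bar> * \<alpha> $ j))"
      proof (rule sum_mono)
        fix j
        have "\<bar>a * c j + b * d j\<bar> \<le> a * \<bar>c j\<bar> + b * \<bar>d j\<bar>"
          using abs_triangle_ineq[of "a * c j" "b * d j"] ab by (simp add: abs_mult)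
        from mult_right_mono[OF this, of "\<alpha> $ j"] pos[of j]
        show "\<bar>a * c j + b * d j\<bar> * \<alpha> $ j \<le> a * (\<bar>c j\<bar> * \<alpha> $ j) + b * (\<bar>d j\<bar> * \<alpha> $ j)"
          by (simp add: algebra_simps)
      qed
      also have "\<dots> = a * (\<Sum>j\<in>UNIV. \<bar>c j\<bar> * \<alpha> $ j) + b * (\<Sum>j\<in>UNIV. \<bar>d j\<bar> * \<alpha> $ j)"
        by (simp add: sum.distrib sum_distrib_left)
      also have "\<dots> \<le> 1"
        using ab y(2) w(2) convex_bound_le[of _ 1] by blast
      finally show "a *\<^sub>R y + b *\<^sub>R w \<in> ?R"
        unfolding y(1) w(1)
        by (intro CollectI exI[of _ "\<lambda>j. a * c j + b * d j"])
          (simp add: scaleR_sum_right sum.distrib scaleR_left_distrib)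
    qed
  qed
  show "?R \<subseteq> scaled_hull x \<alpha>"
  proof
    fix z assume "z \<in> ?R"
    then obtain c where z: "z = (\<Sum>j\<in>UNIV. c j *\<^sub>R x j)" and le: "(\<Sum>j\<in>UNIV. \<bar>c j\<bar> * \<alpha> $ j) \<le> 1"
      by blast
    define s where "s = (\<Sum>j\<in>UNIV. \<bar>c j\<bar> * \<alpha> $ j)"
    have conv: "convex (scaled_hull x \<alpha>)"
      by (simp add: scaled_hull_def)
    have vertex: "inverse (\<alpha> $ i) *\<^sub>R x i \<in> scaled_hull x \<alpha>" "- (inverse (\<alpha> $ i) *\<^sub>R x i) \<in> scaled_hull x \<alpha>" for i
      unfolding scaled_hull_def by (auto intro!: hull_inc)
    have zero: "0 \<in> scaled_hull x \<alpha>"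
      using convexD[OF conv vertex[of undefined], of "1/2" "1/2"] by simp
    have nonneg: "0 \<le> \<bar>c j\<bar> * \<alpha> $ j" for j
      using pos[of j] by simp
    show "z \<in> scaled_hull x \<alpha>"
    proof (cases "s = 0")
      case True
      then have "\<bar>c j\<bar> * \<alpha> $ j = 0" for j
        unfolding s_def using nonneg by (subst (asm) sum_nonneg_eq_0_iff) auto
      then have "c j = 0" for j
        using pos[of j] by (metis abs_0_eq less_irrefl mult_eq_0_iff)
      with zero show ?thesis
        by (simp add: z)
    next
      case False
      then have s: "0 < s" "s \<le> 1"
        using le sum_nonneg[of UNIV "\<lambda>j. \<bar>c j\<bar> * \<alpha> $ j"] nonneg by (auto simp: s_def)
      define y where "y j = sgn (c j) *\<^sub>R inverse (\<alpha> $ j) *\<^sub>R x j" for j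
      have "y j \<in> scaled_hull x \<alpha>" for j
        using vertex[of j] zero by (simp add: y_def sgn_real_def)
      then have "(\<Sum>j\<in>UNIV. (\<bar>c j\<bar> * \<alpha> $ j / s) *\<^sub>R y j) \<in> scaled_hull x \<alpha>"
        using conv nonneg s by (intro convex_sum) (auto simp: sum_divide_distrib[symmetric] s_def)
      from convexD[OF conv this zero, of s "1 - s"] s
      have "s *\<^sub>R (\<Sum>j\<in>UNIV. (\<bar>c j\<bar> * \<alpha> $ j / s) *\<^sub>R y j) \<in> scaled_hull x \<alpha>"
        by simp
      also have "s *\<^sub>R (\<Sum>j\<in>UNIV. (\<bar>c j\<bar> * \<alpha> $ j / s) *\<^sub>R y j) = z"
        unfolding z scaleR_sum_right
      proof (rule sum.cong)
        fix j
        have "\<bar>c j\<bar> * \<alpha> $ j * (sgn (c j) * inverse (\<alpha> $ j)) = c j"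
          using pos[of j] by (simp add: field_simps sgn_real_def)
        then show "s *\<^sub>R (\<bar>c j\<bar> * \<alpha> $ j / s) *\<^sub>R y j = c j *\<^sub>R x j"
          using s by (simp add: y_def field_simps)
      qed simp
      finally show ?thesis .
    qed
  qed
qed

lemma mem_scaleR_scaled_hull_iff:
  fixes x :: "'k::finite \<Rightarrow> 'a::real_vector"
  assumes \<alpha>: "\<alpha> \<in> positive_multiindices" and r: "0 < r"
  shows "z \<in> (\<lambda>y. r *\<^sub>R y) ` scaled_hull x \<alpha> \<longleftrightarrow>
    (\<exists>c. z = (\<Sum>j\<in>UNIV. c j *\<^sub>R x j) \<and> (\<Sum>j\<in>UNIV. \<bar>c j\<bar> * \<alpha> $ j) \<le> r)" (is "?L \<longleftrightarrow> ?R")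
proof
  assume ?L
  then obtain c where "z = r *\<^sub>R (\<Sum>j\<in>UNIV. c j *\<^sub>R x j)" "(\<Sum>j\<in>UNIV. \<bar>c j\<bar> * \<alpha> $ j) \<le> 1"
    unfolding scaled_hull_eq[OF \<alpha>] by blast
  then show ?R
    using r by (intro exI[of _ "\<lambda>j. r * c j"])
      (simp add: scaleR_sum_right abs_mult mult.assoc sum_distrib_left[symmetric])
next
  assume ?R
  then obtain c where c: "z = (\<Sum>j\<in>UNIV. c j *\<^sub>R x j)" "(\<Sum>j\<in>UNIV. \<bar>c j\<bar> * \<alpha> $ j) \<le> r"
    by blast
  have "(\<Sum>j\<in>UNIV. (c j / r) *\<^sub>R x j) \<in> scaled_hull x \<alpha>"
    unfolding scaled_hull_eq[OF \<alpha>] using c(2) r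
    by (intro CollectI exI[of _ "\<lambda>j. c j / r"]) (simp add: abs_div_pos[symmetric] sum_divide_distrib[symmetric])
  moreover have "z = r *\<^sub>R (\<Sum>j\<in>UNIV. (c j / r) *\<^sub>R x j)"
    using r by (simp add: c(1) scaleR_sum_right)
  ultimately show ?L
    by blast
qed

context spanning_directions
begin

lemma combination:
  obtains c where "z = (\<Sum>j\<in>UNIV. c j *\<^sub>R x j)"
  using spanning by blast

lemma hull_gauge_eq:
  assumes \<alpha>: "\<alpha> \<in> positive_multiindices"
  shows "hull_gauge x \<alpha> z =
    Inf {r. r > 0 \<and> (\<exists>c. z = (\<Sum>j\<in>UNIV. c j *\<^sub>R x j) \<and> (\<Sum>j\<in>UNIV. \<bar>c j\<bar> * \<alpha> $ j) \<le> r)}"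
  unfolding hull_gauge_def using mem_scaleR_scaled_hull_iff[OF \<alpha>]
  by (intro arg_cong[where f = Inf] Collect_cong conj_cong refl)

lemma cost_nonneg:
  assumes "\<alpha> \<in> positive_multiindices"
  shows "0 \<le> (\<Sum>j\<in>UNIV. \<bar>c j\<bar> * \<alpha> $ j)"
  using positive_multiindicesD[OF assms] by (intro sum_nonneg mult_nonneg_nonneg) (auto simp: less_imp_le)

text \<open>The next two lemmas say that \<open>hull_gauge x \<alpha> z\<close> is the infimum of the costs of the
  combinations that represent \<open>z\<close>, so the gauge inherits sublinearity from the cost.\<close>

lemma hull_gauge_le:
  assumes \<alpha>: "\<alpha> \<in> positive_multiindices"
  shows "hull_gauge x \<alpha> (\<Sum>j\<in>UNIV. c j *\<^sub>R x j) \<le> (\<Sum>j\<in>UNIV. \<bar>c j\<bar> * \<alpha> $ j)"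
proof (rule dense_ge)
  fix r assume "(\<Sum>j\<in>UNIV. \<bar>c j\<bar> * \<alpha> $ j) < r"
  with cost_nonneg[OF \<alpha>, of c] show "hull_gauge x \<alpha> (\<Sum>j\<in>UNIV. c j *\<^sub>R x j) \<le> r"
    unfolding hull_gauge_eq[OF \<alpha>]
    by (intro cInf_lower bdd_belowI[of _ 0]) (auto intro!: exI[of _ c])
qed

lemma hull_gauge_ge:
  assumes \<alpha>: "\<alpha> \<in> positive_multiindices"
    and ge: "\<And>c. z = (\<Sum>j\<in>UNIV. c j *\<^sub>R x j) \<Longrightarrow> t \<le> (\<Sum>j\<in>UNIV. \<bar>c j\<bar> * \<alpha> $ j)"
  shows "t \<le> hull_gauge x \<alpha> z"
  unfolding hull_gauge_eq[OF \<alpha>]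
proof (rule cInf_greatest)
  obtain c where "z = (\<Sum>j\<in>UNIV. c j *\<^sub>R x j)"
    using combination .
  then have "(\<Sum>j\<in>UNIV. \<bar>c j\<bar> * \<alpha> $ j) + 1 \<in>
      {r. r > 0 \<and> (\<exists>c. z = (\<Sum>j\<in>UNIV. c j *\<^sub>R x j) \<and> (\<Sum>j\<in>UNIV. \<bar>c j\<bar> * \<alpha> $ j) \<le> r)}"
    using cost_nonneg[OF \<alpha>, of c] by (auto intro!: exI[of _ c])
  then show "{r. r > 0 \<and> (\<exists>c. z = (\<Sum>j\<in>UNIV. c j *\<^sub>R x j) \<and> (\<Sum>j\<in>UNIV. \<bar>c j\<bar> * \<alpha> $ j) \<le> r)} \<noteq> {}"
    by blast
next
  fix r assume "r \<in> {r. r > 0 \<and> (\<exists>c. z = (\<Sum>j\<in>UNIV. c j *\<^sub>R x j) \<and> (\<Sum>j\<in>UNIV. \<bar>c j\<bar> * \<alpha> $ j) \<le> r)}"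
  then show "t \<le> r"
    using ge by force
qed

lemma hull_gauge_less:
  assumes "\<alpha> \<in> positive_multiindices" "hull_gauge x \<alpha> z < t"
  obtains c where "z = (\<Sum>j\<in>UNIV. c j *\<^sub>R x j)" "(\<Sum>j\<in>UNIV. \<bar>c j\<bar> * \<alpha> $ j) < t"
  using hull_gauge_ge[OF assms(1), of z t] assms(2) by fastforce

lemma hull_gauge_direction_le:
  assumes \<alpha>: "\<alpha> \<in> positive_multiindices"
  shows "hull_gauge x \<alpha> (x i) \<le> \<alpha> $ i"
proof -
  have direction: "x i = (\<Sum>j\<in>UNIV. (if j = i then 1 else 0) *\<^sub>R x j)"
    by (simp add: if_distrib[of "\<lambda>c. c *\<^sub>R _"] cong: if_cong)
  have cost: "(\<Sum>j\<in>UNIV. \<bar>if j = i then 1 else 0\<bar> * \<alpha> $ j) = \<alpha> $ i"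
    by (simp add: if_distrib[of "\<lambda>c. c * _"] cong: if_cong)
  show ?thesis
    using hull_gauge_le[OF \<alpha>, of "\<lambda>j. if j = i then 1 else 0"]
    by (simp only: direction[symmetric] cost)
qed

text \<open>If \<open>x\<^sub>i\<close> has a representation of cost \<open>s < \<alpha>\<^sub>i\<close>, then \<open>x\<^sub>i / s\<close> already lies in the hull,
  so lowering \<open>\<alpha>\<^sub>i\<close> to \<open>s\<close> adds nothing to it; conversely, if lowering \<open>\<alpha>\<^sub>i\<close> does not change
  the gauge, then the gauge at \<open>x\<^sub>i\<close> is below \<open>\<alpha>\<^sub>i\<close>. The criterion is a family of weak
  inequalities between linear functions of \<open>\<alpha>\<close>, hence survives limits.\<close>

lemma admissible_iff:
  assumes \<alpha>: "\<alpha> \<in> positive_multiindices"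
  shows "admissible x \<alpha> \<longleftrightarrow>
    (\<forall>i c. x i = (\<Sum>j\<in>UNIV. c j *\<^sub>R x j) \<longrightarrow> \<alpha> $ i \<le> (\<Sum>j\<in>UNIV. \<bar>c j\<bar> * \<alpha> $ j))"
    (is "_ \<longleftrightarrow> ?R")
proof (rule iffI; rule ccontr)
  note pos = positive_multiindicesD[OF \<alpha>]
  assume adm: "admissible x \<alpha>" and "\<not> ?R"
  then obtain i c where c: "x i = (\<Sum>j\<in>UNIV. c j *\<^sub>R x j)" "(\<Sum>j\<in>UNIV. \<bar>c j\<bar> * \<alpha> $ j) < \<alpha> $ i"
    by (auto simp: not_le)
  define s where "s = (\<Sum>j\<in>UNIV. \<bar>c j\<bar> * \<alpha> $ j)"
  have "s \<noteq> 0"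
  proof
    assume "s = 0"
    then have "\<bar>c j\<bar> * \<alpha> $ j = 0" for j
      unfolding s_def using pos by (subst (asm) sum_nonneg_eq_0_iff) (auto simp: less_imp_le)
    then have "c j = 0" for j
      using pos[of j] by (metis abs_0_eq less_irrefl mult_eq_0_iff)
    then have "x i = 0"
      using c(1) by simp
    with unit[of i] show False
      by simp
  qed
  then have s: "0 < s" "s < \<alpha> $ i"
    using cost_nonneg[OF \<alpha>, of c] c(2) by (auto simp: s_def)
  define \<beta> :: "real ^ 'k" where "\<beta> = (\<chi> j. if j = i then \<alpha> $ j - (\<alpha> $ i - s) else \<alpha> $ j)"
  have \<beta>: "\<beta> $ j = (if j = i then s else \<alpha> $ j)" for j
    by (simp add: \<beta>_def)
  have \<beta>_pos: "\<beta> \<in> positive_multiindices"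
    using s pos by (auto simp: positive_multiindices_def \<beta>)
  have "scaled_hull x \<beta> = scaled_hull x \<alpha>"
  proof
    \<comment> \<open>The hull of \<open>\<alpha>\<close> contains the new vertex, because it has cost \<open>1\<close>.\<close>
    have *: "t *\<^sub>R inverse s *\<^sub>R x i \<in> scaled_hull x \<alpha>" if "\<bar>t\<bar> = 1" for t :: real
      unfolding scaled_hull_eq[OF \<alpha>] using s that
      by (intro CollectI exI[of _ "\<lambda>j. t * inverse s * c j"])
        (simp add: c(1) abs_mult mult.assoc scaleR_sum_right sum_distrib_left[symmetric] s_def[symmetric])
    have "(\<Union>j. {inverse (\<beta> $ j) *\<^sub>R x j, - (inverse (\<beta> $ j) *\<^sub>R x j)}) \<subseteq> scaled_hull x \<alpha>"
      using *[of 1] *[of "-1"] by (auto simp: \<beta>) (auto simp: scaled_hull_def intro!: hull_inc)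
    then show "scaled_hull x \<beta> \<subseteq> scaled_hull x \<alpha>"
      unfolding scaled_hull_def[of x \<beta>] by (rule hull_minimal) (simp add: scaled_hull_def)
    have "(\<Sum>j\<in>UNIV. \<bar>d j\<bar> * \<beta> $ j) \<le> (\<Sum>j\<in>UNIV. \<bar>d j\<bar> * \<alpha> $ j)" for d
      using s by (intro sum_mono mult_left_mono) (auto simp: \<beta>)
    then show "scaled_hull x \<alpha> \<subseteq> scaled_hull x \<beta>"
      unfolding scaled_hull_eq[OF \<alpha>] scaled_hull_eq[OF \<beta>_pos] by (blast intro: order_trans)
  qed
  then have "hull_gauge x \<beta> = hull_gauge x \<alpha>"
    by (simp add: hull_gauge_def)
  then show False
    using adm s unfolding admissible_def \<beta>_def by (metis diff_gt_0_iff_gt diff_less_eq less_add_same_cancel1)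
next
  note pos = positive_multiindicesD[OF \<alpha>]
  assume R: ?R and "\<not> admissible x \<alpha>"
  then obtain i \<epsilon> where \<epsilon>: "0 < \<epsilon>" "\<epsilon> < \<alpha> $ i"
    and eq: "hull_gauge x (\<chi> j. if j = i then \<alpha> $ j - \<epsilon> else \<alpha> $ j) = hull_gauge x \<alpha>"
    unfolding admissible_def by blast
  have "(\<chi> j. if j = i then \<alpha> $ j - \<epsilon> else \<alpha> $ j) \<in> positive_multiindices"
    using \<epsilon> pos by (auto simp: positive_multiindices_def)
  from hull_gauge_direction_le[OF this, of i] have "hull_gauge x \<alpha> (x i) \<le> \<alpha> $ i - \<epsilon>"
    by (simp add: eq)
  also have "\<dots> < \<alpha> $ i"
    using \<epsilon> by simp
  finally obtain c where "x i = (\<Sum>j\<in>UNIV. c j *\<^sub>R x j)" "(\<Sum>j\<in>UNIV. \<bar>c j\<bar> * \<alpha> $ j) < \<alpha> $ i"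
    using hull_gauge_less[OF \<alpha>] by blast
  with R show False
    by (meson not_le)
qed

lemma admissible_multiindices_iff:
  "\<alpha> \<in> admissible_multiindices x \<longleftrightarrow> \<alpha> \<in> positive_multiindices \<and>
    (\<forall>i c. x i = (\<Sum>j\<in>UNIV. c j *\<^sub>R x j) \<longrightarrow> \<alpha> $ i \<le> (\<Sum>j\<in>UNIV. \<bar>c j\<bar> * \<alpha> $ j))"
  using admissible_iff by (auto simp: admissible_multiindices_def)

lemma hull_gauge_direction:
  assumes "\<alpha> \<in> admissible_multiindices x"
  shows "hull_gauge x \<alpha> (x i) = \<alpha> $ i"
proof (rule order_antisym)
  show "hull_gauge x \<alpha> (x i) \<le> \<alpha> $ i"
    using assms by (intro hull_gauge_direction_le) (simp add: admissible_multiindices_def)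
  show "\<alpha> $ i \<le> hull_gauge x \<alpha> (x i)"
    using assms by (intro hull_gauge_ge) (auto simp: admissible_multiindices_iff)
qed

end

section \<open>Norms whose unit ball is a scaled hull\<close>

text \<open>Minkowski's theorem for compact convex sets in an arbitrary finite-dimensional space:
  extreme points and convex hulls are preserved by an embedding into a Euclidean space.\<close>

lemma convex_hull_Ext_embedding:
  fixes \<phi> :: "'a::real_normed_vector \<Rightarrow> 'b::euclidean_space" and B :: "'a set"
  assumes \<phi>: "bounded_linear \<phi>" "inj \<phi>" and B: "compact B" "convex B"
  shows "B = convex hull (Ext B)"
proof -
  interpret bounded_linear \<phi> by (rule \<phi>)
  have "continuous_on B \<phi>"
    by (rule linear_continuous_on[OF \<phi>(1)])
  then have "compact (\<phi> ` B)" "convex (\<phi> ` B)"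
    using B convex_linear_image[OF linear_axioms] by (auto intro: compact_continuous_image)
  then have "\<phi> ` B = convex hull {y. y extreme_point_of \<phi> ` B}"
    by (rule Krein_Milman_Minkowski)
  also have "\<dots> \<subseteq> convex hull (\<phi> ` Ext B)"
  proof (rule hull_mono, rule subsetI)
    fix y assume "y \<in> {y. y extreme_point_of \<phi> ` B}"
    then have y: "y \<in> \<phi> ` B" "\<And>a b. a \<in> \<phi> ` B \<Longrightarrow> b \<in> \<phi> ` B \<Longrightarrow> y \<notin> open_segment a b"
      by (auto simp: extreme_point_of_def)
    then obtain z where z: "z \<in> B" "y = \<phi> z"
      by blast
    have "z \<notin> open_segment a b" if "a \<in> B" "b \<in> B" for a b
    proof
      assume "z \<in> open_segment a b"
      then have "\<phi> z \<in> open_segment (\<phi> a) (\<phi> b)"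
        using \<phi>(2) by (auto simp: in_segment add scaleR inj_eq)
      with y(2)[of "\<phi> a" "\<phi> b"] that z(2) show False
        by blast
    qed
    with z show "y \<in> \<phi> ` Ext B"
      by (auto simp: Ext_def extreme_point_of_def)
  qed
  also have "convex hull (\<phi> ` Ext B) = \<phi> ` (convex hull (Ext B))"
    using convex_hull_linear_image[OF linear_axioms] by metis
  finally have "B \<subseteq> convex hull (Ext B)"
    using \<phi>(2) by (simp add: inj_image_subset_iff)
  moreover have "convex hull (Ext B) \<subseteq> B"
    using B(2) by (intro hull_minimal) (auto simp: Ext_def extreme_point_of_def)
  ultimately show ?thesis
    by blast
qed

lemma equivalent_norms_sum_le:
  assumes p: "p \<in> equivalent_norms"
  shows "p (\<Sum>j\<in>A. c j *\<^sub>R y j) \<le> (\<Sum>j\<in>A. \<bar>c j\<bar> * p (y j))"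
proof (induction A rule: infinite_finite_induct)
  case (insert j A)
  then show ?case
    using equivalent_normsD(4)[OF p, of "c j *\<^sub>R y j" "\<Sum>j\<in>A. c j *\<^sub>R y j"]
    by (simp add: equivalent_normsD(3)[OF p])
qed (simp_all add: equivalent_norms_zero[OF p])

lemma continuous_on_equivalent_norm:
  assumes p: "p \<in> equivalent_norms"
  shows "continuous_on S p"
proof -
  obtain b where b: "0 < b" "\<And>z. p z \<le> b * norm z"
    using equivalent_normsD(5)[OF p] by blast
  have "dist (p y) (p z) \<le> b * dist y z" for y z
  proof -
    have "p y \<le> p (y - z) + p z" "p z \<le> p (y - z) + p y"
      using equivalent_normsD(4)[OF p, of "y - z" z] equivalent_normsD(4)[OF p, of "z - y" y]
        equivalent_norms_minus[OF p, of "y - z"] by simp_all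
    with b(2)[of "y - z"] show ?thesis
      by (simp add: dist_norm abs_le_iff)
  qed
  then have "b-lipschitz_on S p"
    using b(1) by (intro lipschitz_onI) auto
  then show ?thesis
    by (rule lipschitz_on_continuous_on)
qed

lemma convex_unit_ball:
  assumes p: "p \<in> equivalent_norms"
  shows "convex (unit_ball p)"
proof (rule convexI)
  fix y z and u v :: real
  assume yz: "y \<in> unit_ball p" "z \<in> unit_ball p" and uv: "0 \<le> u" "0 \<le> v" "u + v = 1"
  have "p (u *\<^sub>R y + v *\<^sub>R z) \<le> u * p y + v * p z"
    using equivalent_normsD(4)[OF p, of "u *\<^sub>R y" "v *\<^sub>R z"] uv
    by (simp add: equivalent_normsD(3)[OF p])
  also have "\<dots> \<le> 1"
    using yz uv by (intro convex_bound_le) (auto simp: unit_ball_def)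
  finally show "u *\<^sub>R y + v *\<^sub>R z \<in> unit_ball p"
    by (simp add: unit_ball_def)
qed

context spanning_directions
begin

lemma euclidean_embedding:
  obtains \<phi> :: "'a \<Rightarrow> real ^ 'k" where "bounded_linear \<phi>" "inj \<phi>"
proof -
  define \<psi> :: "real ^ 'k \<Rightarrow> 'a" where "\<psi> v = (\<Sum>j\<in>UNIV. v $ j *\<^sub>R x j)" for v
  have "linear \<psi>"
    by (rule linearI) (simp_all add: \<psi>_def scaleR_left_distrib sum.distrib scaleR_sum_right)
  moreover have "surj \<psi>"
    unfolding surj_def
  proof
    fix z
    obtain c where "z = (\<Sum>j\<in>UNIV. c j *\<^sub>R x j)"
      using combination .
    then have "z = \<psi> (\<chi> j. c j)"
      by (simp add: \<psi>_def)
    then show "\<exists>v. z = \<psi> v" ..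
  qed
  ultimately obtain \<phi> where \<phi>: "linear \<phi>" "\<psi> \<circ> \<phi> = id"
    using linear_surjective_right_inverse by blast
  have "norm (\<phi> z) \<le> norm z * (K * (\<Sum>j\<in>UNIV. norm (\<phi> (x j))))" for z
  proof -
    obtain c where c: "z = (\<Sum>j\<in>UNIV. c j *\<^sub>R x j)" "(\<Sum>j\<in>UNIV. \<bar>c j\<bar>) \<le> K * norm z"
      using spanning by blast
    let ?M = "\<Sum>j\<in>UNIV. norm (\<phi> (x j))"
    have "\<phi> z = (\<Sum>j\<in>UNIV. c j *\<^sub>R \<phi> (x j))"
      using \<phi>(1) by (simp add: c(1) linear_sum linear_cmul)
    also have "norm \<dots> \<le> (\<Sum>j\<in>UNIV. \<bar>c j\<bar> * ?M)"
    proof (rule sum_norm_le)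
      fix j
      have "norm (\<phi> (x j)) \<le> ?M"
        by (intro member_le_sum) auto
      then show "norm (c j *\<^sub>R \<phi> (x j)) \<le> \<bar>c j\<bar> * ?M"
        by (simp add: mult_left_mono)
    qed
    also have "\<dots> = (\<Sum>j\<in>UNIV. \<bar>c j\<bar>) * ?M"
      by (simp add: sum_distrib_right)
    also have "\<dots> \<le> K * norm z * ?M"
      using c(2) by (intro mult_right_mono) (auto simp: sum_nonneg)
    finally show ?thesis
      by (simp add: mult_ac)
  qed
  then have "bounded_linear \<phi>"
    using \<phi>(1) by (intro bounded_linear_intro) (auto simp: linear_add linear_cmul)
  moreover have "inj \<phi>"
    using \<phi>(2) by (metis inj_on_id inj_on_imageI2)
  ultimately show ?thesis
    using that by blast
qed

lemma compact_scaled_hull: "compact (scaled_hull x \<alpha>)"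
  unfolding scaled_hull_def by (rule finite_imp_compact_convex_hull) simp

lemma compact_unit_ball:
  fixes p :: "'a \<Rightarrow> real"
  assumes p: "p \<in> equivalent_norms"
  shows "compact (unit_ball p)"
proof -
  obtain a where a: "0 < a" "\<And>z. a * norm z \<le> p z"
    using equivalent_normsD(5)[OF p] by blast
  define \<alpha> :: "real ^ 'k" where "\<alpha> = (\<chi> j. a / K)"
  have \<alpha>: "\<alpha> \<in> positive_multiindices"
    using a K_pos by (simp add: \<alpha>_def positive_multiindices_def)
  have "unit_ball p \<subseteq> scaled_hull x \<alpha>"
  proof
    fix z assume "z \<in> unit_ball p"
    then have z: "a * norm z \<le> 1"
      using a(2)[of z] by (simp add: unit_ball_def)
    obtain c where c: "z = (\<Sum>j\<in>UNIV. c j *\<^sub>R x j)" "(\<Sum>j\<in>UNIV. \<bar>c j\<bar>) \<le> K * norm z"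
      using spanning by blast
    have "(\<Sum>j\<in>UNIV. \<bar>c j\<bar> * \<alpha> $ j) = (\<Sum>j\<in>UNIV. \<bar>c j\<bar>) * (a / K)"
      by (simp add: \<alpha>_def sum_distrib_right sum_divide_distrib)
    also have "\<dots> \<le> K * norm z * (a / K)"
      using c(2) a K_pos by (intro mult_right_mono) auto
    also have "\<dots> \<le> 1"
      using z K_pos by (simp add: mult.commute)
    finally show "z \<in> scaled_hull x \<alpha>"
      unfolding scaled_hull_eq[OF \<alpha>] using c(1) by blast
  qed
  moreover have "closed (unit_ball p)"
    unfolding unit_ball_def
    by (intro closed_Collect_le continuous_on_equivalent_norm[OF p] continuous_on_const)
  ultimately show ?thesis
    using compact_scaled_hull[of \<alpha>] by (metis compact_Int_closed inf.absorb2)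
qed

text \<open>The extreme points of the unit ball are among \<open>\<plusminus> t x\<^sub>i\<close> with \<open>t \<le> 1 / p x\<^sub>i\<close>, so
  the ball is the scaled hull of the values \<open>p x\<^sub>i\<close>. Every vector is then a combination of
  the directions on which the triangle inequality for \<open>p\<close> is an equality.\<close>

lemma norms_on_combination:
  assumes p: "p \<in> norms_on (\<Union>i. {x i, - x i})"
  obtains c where "z = (\<Sum>j\<in>UNIV. c j *\<^sub>R x j)" "(\<Sum>j\<in>UNIV. \<bar>c j\<bar> * p (x j)) \<le> p z"
proof (cases "z = 0")
  case True
  then show ?thesis
    using p that[of "\<lambda>_. 0"] equivalent_normsD(1)[of p] by (simp add: norms_on_def)
next
  case False
  have pn: "p \<in> equivalent_norms" and Ext: "Ext (unit_ball p) \<subseteq> Dir (\<Union>i. {x i, - x i})"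
    using p by (auto simp: norms_on_def)
  define \<alpha> :: "real ^ 'k" where "\<alpha> = (\<chi> i. p (x i))"
  have x: "x i \<noteq> 0" for i
    using unit[of i] by auto
  have \<alpha>: "\<alpha> \<in> positive_multiindices"
    using equivalent_norms_pos[OF pn x] by (simp add: \<alpha>_def positive_multiindices_def)
  have "Ext (unit_ball p) \<subseteq> scaled_hull x \<alpha>"
  proof
    fix y assume y: "y \<in> Ext (unit_ball p)"
    then obtain t e where te: "0 < t" "e \<in> (\<Union>i. {x i, - x i})" "y = t *\<^sub>R e"
      using Ext unfolding Dir_def by blast
    then obtain i where "e = x i \<or> e = - x i"
      by blast
    then obtain s where s: "y = s *\<^sub>R x i" "\<bar>s\<bar> = t"
      using te(1,3) by (metis abs_minus_cancel abs_of_pos scaleR_minus_left scaleR_minus_right)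
    have "p y \<le> 1"
      using y by (simp add: Ext_def extreme_point_of_def unit_ball_def)
    then have le: "\<bar>s\<bar> * p (x i) \<le> 1"
      by (simp add: s(1) equivalent_normsD(3)[OF pn])
    have "y = (\<Sum>j\<in>UNIV. (if j = i then s else 0) *\<^sub>R x j)"
      by (simp add: s(1) if_distrib[of "\<lambda>c. c *\<^sub>R _"] cong: if_cong)
    moreover have "(\<Sum>j\<in>UNIV. \<bar>if j = i then s else 0\<bar> * \<alpha> $ j) = (\<Sum>j\<in>UNIV. if j = i then \<bar>s\<bar> * p (x i) else 0)"
      by (intro sum.cong) (auto simp: \<alpha>_def)
    then have "(\<Sum>j\<in>UNIV. \<bar>if j = i then s else 0\<bar> * \<alpha> $ j) \<le> 1"
      using le by simp
    ultimately show "y \<in> scaled_hull x \<alpha>"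
      unfolding scaled_hull_eq[OF \<alpha>]
      by (intro CollectI exI[of _ "\<lambda>j. if j = i then s else 0"] conjI)
  qed
  then have hull: "convex hull (Ext (unit_ball p)) \<subseteq> scaled_hull x \<alpha>"
    by (rule hull_minimal) (simp add: scaled_hull_def)
  obtain \<phi> :: "'a \<Rightarrow> real ^ 'k" where "bounded_linear \<phi>" "inj \<phi>"
    using euclidean_embedding .
  then have "unit_ball p = convex hull (Ext (unit_ball p))"
    using compact_unit_ball[OF pn] convex_unit_ball[OF pn] by (rule convex_hull_Ext_embedding)
  with hull have ball: "unit_ball p \<subseteq> scaled_hull x \<alpha>"
    by (rule ord_eq_le_trans[rotated])
  have pz: "0 < p z"
    using equivalent_norms_pos[OF pn False] .
  then have "inverse (p z) *\<^sub>R z \<in> unit_ball p"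
    by (simp add: unit_ball_def equivalent_normsD(3)[OF pn])
  with ball have "inverse (p z) *\<^sub>R z \<in> scaled_hull x \<alpha>"
    by blast
  then have "p z *\<^sub>R inverse (p z) *\<^sub>R z \<in> (\<lambda>y. p z *\<^sub>R y) ` scaled_hull x \<alpha>"
    by (rule imageI)
  then have "z \<in> (\<lambda>y. p z *\<^sub>R y) ` scaled_hull x \<alpha>"
    using pz by simp
  then obtain c where "z = (\<Sum>j\<in>UNIV. c j *\<^sub>R x j)" "(\<Sum>j\<in>UNIV. \<bar>c j\<bar> * \<alpha> $ j) \<le> p z"
    unfolding mem_scaleR_scaled_hull_iff[OF \<alpha> pz] by blast
  then show ?thesis
    using that by (simp add: \<alpha>_def)
qed

lemma norms_on_le:
  assumes p: "p \<in> norms_on (\<Union>i. {x i, - x i})" and q: "q \<in> equivalent_norms"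
    and u: "0 \<le> u" and le: "\<And>i. q (x i) \<le> u * p (x i)"
  shows "q z \<le> u * p z"
proof -
  obtain c where c: "z = (\<Sum>j\<in>UNIV. c j *\<^sub>R x j)" "(\<Sum>j\<in>UNIV. \<bar>c j\<bar> * p (x j)) \<le> p z"
    using norms_on_combination[OF p] .
  have "q z \<le> (\<Sum>j\<in>UNIV. \<bar>c j\<bar> * q (x j))"
    unfolding c(1) by (rule equivalent_norms_sum_le[OF q])
  also have "\<dots> \<le> (\<Sum>j\<in>UNIV. \<bar>c j\<bar> * (u * p (x j)))"
    using le by (intro sum_mono mult_left_mono) auto
  also have "\<dots> = u * (\<Sum>j\<in>UNIV. \<bar>c j\<bar> * p (x j))"
    by (simp add: sum_distrib_left mult_ac)
  also have "\<dots> \<le> u * p z"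
    using c(2) u by (rule mult_left_mono)
  finally show ?thesis .
qed

text \<open>By the triangle inequality, no combination that represents \<open>x\<^sub>i\<close> costs less than \<open>p x\<^sub>i\<close>.\<close>

lemma norm_values_admissible:
  assumes p: "p \<in> equivalent_norms"
  shows "(\<chi> i. p (x i)) \<in> admissible_multiindices x"
  unfolding admissible_multiindices_iff
proof (intro conjI allI impI)
  have "x i \<noteq> 0" for i
    using unit[of i] by auto
  then show "(\<chi> i. p (x i)) \<in> positive_multiindices"
    using equivalent_norms_pos[OF p] by (simp add: positive_multiindices_def)
  fix i c assume "x i = (\<Sum>j\<in>UNIV. c j *\<^sub>R x j)"
  then have "p (x i) \<le> (\<Sum>j\<in>UNIV. \<bar>c j\<bar> * p (x j))"
    using equivalent_norms_sum_le[OF p, of c x UNIV] by metis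
  then show "(\<chi> i. p (x i)) $ i \<le> (\<Sum>j\<in>UNIV. \<bar>c j\<bar> * (\<chi> i. p (x i)) $ j)"
    by simp
qed

lemma hull_gauge_equivalent_norm:
  assumes \<alpha>: "\<alpha> \<in> positive_multiindices"
  shows "hull_gauge x \<alpha> \<in> equivalent_norms"
proof -
  note pos = positive_multiindicesD[OF \<alpha>]
  let ?g = "hull_gauge x \<alpha>"
  have nonneg: "0 \<le> ?g z" for z
    using cost_nonneg[OF \<alpha>] by (rule hull_gauge_ge[OF \<alpha>])
  define m where "m = (MIN j. \<alpha> $ j)"
  have m: "0 < m" "\<And>j. m \<le> \<alpha> $ j"
    using pos by (auto simp: m_def)
  have lower: "m * norm z \<le> ?g z" for z
  proof (rule hull_gauge_ge[OF \<alpha>])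
    fix c assume z: "z = (\<Sum>j\<in>UNIV. c j *\<^sub>R x j)"
    have "norm z \<le> (\<Sum>j\<in>UNIV. \<bar>c j\<bar>)"
      unfolding z by (rule sum_norm_le) (simp add: unit)
    then have "m * norm z \<le> m * (\<Sum>j\<in>UNIV. \<bar>c j\<bar>)"
      using m(1) by simp
    also have "\<dots> = (\<Sum>j\<in>UNIV. \<bar>c j\<bar> * m)"
      by (simp add: sum_distrib_left mult.commute)
    also have "\<dots> \<le> (\<Sum>j\<in>UNIV. \<bar>c j\<bar> * \<alpha> $ j)"
      using m(2) by (intro sum_mono mult_left_mono) auto
    finally show "m * norm z \<le> (\<Sum>j\<in>UNIV. \<bar>c j\<bar> * \<alpha> $ j)" .
  qed
  define M where "M = (MAX j. \<alpha> $ j)"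
  have M: "\<And>j. \<alpha> $ j \<le> M"
    by (auto simp: M_def)
  then have M_pos: "0 < M"
    using pos order_less_le_trans by blast
  have upper: "?g z \<le> (M * K) * norm z" for z
  proof -
    obtain c where c: "z = (\<Sum>j\<in>UNIV. c j *\<^sub>R x j)" "(\<Sum>j\<in>UNIV. \<bar>c j\<bar>) \<le> K * norm z"
      using spanning by blast
    have "?g z \<le> (\<Sum>j\<in>UNIV. \<bar>c j\<bar> * \<alpha> $ j)"
      unfolding c(1) by (rule hull_gauge_le[OF \<alpha>])
    also have "\<dots> \<le> (\<Sum>j\<in>UNIV. \<bar>c j\<bar> * M)"
      using M by (intro sum_mono mult_left_mono) auto
    also have "\<dots> = M * (\<Sum>j\<in>UNIV. \<bar>c j\<bar>)"
      by (simp add: sum_distrib_left mult.commute)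
    also have "\<dots> \<le> M * (K * norm z)"
      using c(2) M_pos by (intro mult_left_mono) auto
    finally show ?thesis
      by (simp add: mult.assoc)
  qed
  have zero: "?g z = 0 \<longleftrightarrow> z = 0" for z
  proof
    assume "?g z = 0"
    with lower[of z] m(1) show "z = 0"
      by (simp add: mult_le_0_iff)
  next
    assume "z = 0"
    with upper[of 0] nonneg[of 0] show "?g z = 0"
      by simp
  qed
  have triangle: "?g (y + z) \<le> ?g y + ?g z" for y z
  proof -
    have *: "?g (y + z) - (\<Sum>j\<in>UNIV. \<bar>d j\<bar> * \<alpha> $ j) \<le> ?g y" if z: "z = (\<Sum>j\<in>UNIV. d j *\<^sub>R x j)" for d
    proof (rule hull_gauge_ge[OF \<alpha>])
      fix c assume y: "y = (\<Sum>j\<in>UNIV. c j *\<^sub>R x j)"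
      have "?g (y + z) = ?g (\<Sum>j\<in>UNIV. (c j + d j) *\<^sub>R x j)"
        by (simp add: y z scaleR_left_distrib sum.distrib)
      also have "\<dots> \<le> (\<Sum>j\<in>UNIV. \<bar>c j + d j\<bar> * \<alpha> $ j)"
        by (rule hull_gauge_le[OF \<alpha>])
      also have "\<dots> \<le> (\<Sum>j\<in>UNIV. (\<bar>c j\<bar> + \<bar>d j\<bar>) * \<alpha> $ j)"
        using pos by (intro sum_mono mult_right_mono) (auto simp: less_imp_le)
      finally show "?g (y + z) - (\<Sum>j\<in>UNIV. \<bar>d j\<bar> * \<alpha> $ j) \<le> (\<Sum>j\<in>UNIV. \<bar>c j\<bar> * \<alpha> $ j)"
        by (simp add: distrib_right sum.distrib)
    qed
    have "?g (y + z) - ?g y \<le> ?g z"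
      using * by (intro hull_gauge_ge[OF \<alpha>]) (simp add: algebra_simps)
    then show ?thesis
      by simp
  qed
  have scale_le: "?g (t *\<^sub>R z) \<le> \<bar>t\<bar> * ?g z" if "t \<noteq> 0" for t z
  proof -
    have "?g (t *\<^sub>R z) / \<bar>t\<bar> \<le> ?g z"
    proof (rule hull_gauge_ge[OF \<alpha>])
      fix c assume z: "z = (\<Sum>j\<in>UNIV. c j *\<^sub>R x j)"
      have "?g (t *\<^sub>R z) = ?g (\<Sum>j\<in>UNIV. (t * c j) *\<^sub>R x j)"
        by (simp add: z scaleR_sum_right)
      also have "\<dots> \<le> (\<Sum>j\<in>UNIV. \<bar>t * c j\<bar> * \<alpha> $ j)"
        by (rule hull_gauge_le[OF \<alpha>])
      also have "\<dots> = \<bar>t\<bar> * (\<Sum>j\<in>UNIV. \<bar>c j\<bar> * \<alpha> $ j)"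
        by (simp add: abs_mult sum_distrib_left mult.assoc)
      finally show "?g (t *\<^sub>R z) / \<bar>t\<bar> \<le> (\<Sum>j\<in>UNIV. \<bar>c j\<bar> * \<alpha> $ j)"
        using that by (simp add: field_simps)
    qed
    with that show ?thesis
      by (simp add: field_simps)
  qed
  have "?g (t *\<^sub>R z) = \<bar>t\<bar> * ?g z" for t z
  proof (cases "t = 0")
    case True
    then show ?thesis
      using zero[of 0] by simp
  next
    case False
    then have "\<bar>t\<bar> * ?g z \<le> ?g (t *\<^sub>R z)"
      using scale_le[of "inverse t" "t *\<^sub>R z"] by (simp add: field_simps)
    with scale_le[OF False, of z] show ?thesis
      by linarith
  qed
  moreover have "\<exists>a>0. \<exists>b>0. \<forall>z. a * norm z \<le> ?g z \<and> ?g z \<le> b * norm z"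
    using m(1) M_pos K_pos lower upper by (metis mult_pos_pos)
  ultimately show ?thesis
    using nonneg zero triangle unfolding equivalent_norms_def by blast
qed

text \<open>A vector of gauge at most \<open>1\<close> lies in every dilate of the hull by a factor \<open>r > 1\<close>,
  and the hull is closed.\<close>

lemma unit_ball_hull_gauge:
  assumes \<alpha>: "\<alpha> \<in> positive_multiindices"
  shows "unit_ball (hull_gauge x \<alpha>) = scaled_hull x \<alpha>"
proof
  show "scaled_hull x \<alpha> \<subseteq> unit_ball (hull_gauge x \<alpha>)"
    using hull_gauge_le[OF \<alpha>] unfolding scaled_hull_eq[OF \<alpha>] unit_ball_def
    by (auto intro: order_trans)
  show "unit_ball (hull_gauge x \<alpha>) \<subseteq> scaled_hull x \<alpha>"
  proof
    fix z assume "z \<in> unit_ball (hull_gauge x \<alpha>)"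
    then have z: "hull_gauge x \<alpha> z \<le> 1"
      by (simp add: unit_ball_def)
    define r where "r n = 1 + 1 / real (Suc n)" for n
    have r: "1 < r n" for n
      by (simp add: r_def)
    have "inverse (r n) *\<^sub>R z \<in> scaled_hull x \<alpha>" for n
    proof -
      have "hull_gauge x \<alpha> z < r n"
        using z r[of n] by linarith
      then obtain c where "z = (\<Sum>j\<in>UNIV. c j *\<^sub>R x j)" "(\<Sum>j\<in>UNIV. \<bar>c j\<bar> * \<alpha> $ j) < r n"
        using hull_gauge_less[OF \<alpha>] by blast
      then have "z \<in> (\<lambda>y. r n *\<^sub>R y) ` scaled_hull x \<alpha>"
        using r[of n] mem_scaleR_scaled_hull_iff[OF \<alpha>, of "r n" z x] by fastforce
      then show ?thesis
        using r[of n] by auto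
    qed
    moreover have "(\<lambda>n. inverse (r n) *\<^sub>R z) \<longlonglongrightarrow> inverse (1 + 0) *\<^sub>R z"
      unfolding r_def by (intro tendsto_intros LIMSEQ_Suc[OF lim_1_over_n]) simp
    ultimately have "inverse (1 + 0) *\<^sub>R z \<in> scaled_hull x \<alpha>"
      by (rule closed_sequentially[OF compact_imp_closed[OF compact_scaled_hull]])
    then show "z \<in> scaled_hull x \<alpha>"
      by simp
  qed
qed

lemma hull_gauge_norms_on:
  assumes \<alpha>: "\<alpha> \<in> positive_multiindices"
  shows "hull_gauge x \<alpha> \<in> norms_on (\<Union>i. {x i, - x i})"
  unfolding norms_on_def
proof (intro CollectI conjI subsetI)
  show "hull_gauge x \<alpha> \<in> equivalent_norms"
    using hull_gauge_equivalent_norm[OF \<alpha>] .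
  fix z assume "z \<in> Ext (unit_ball (hull_gauge x \<alpha>))"
  then have "z extreme_point_of scaled_hull x \<alpha>"
    by (simp add: Ext_def unit_ball_hull_gauge[OF \<alpha>])
  then obtain i where "z = inverse (\<alpha> $ i) *\<^sub>R x i \<or> z = inverse (\<alpha> $ i) *\<^sub>R (- x i)"
    unfolding scaled_hull_def by (auto dest: extreme_point_of_convex_hull)
  moreover have "0 < inverse (\<alpha> $ i)"
    using positive_multiindicesD[OF \<alpha>] by simp
  ultimately show "z \<in> Dir (\<Union>i. {x i, - x i})"
    unfolding Dir_def by blast
qed

end

section \<open>Completeness\<close>

text \<open>If the hull contains a ball about \<open>w\<close>, a vector \<open>v\<close> of small norm is the difference of
  \<open>w + v\<close> and \<open>w\<close>, hence a combination of the directions with coefficients of absolute sum at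
  most \<open>2\<close>; the general case follows by scaling.\<close>

lemma direction_set_spanning:
  fixes x :: "'k::finite \<Rightarrow> 'a::real_normed_vector"
  assumes E: "direction_set E" "E = (\<Union>i. {x i, - x i})"
  obtains K where "spanning_directions x K"
proof -
  have "x i \<in> sphere 0 1" for i
    using E unfolding direction_set_def by blast
  then have unit: "norm (x i) = 1" for i
    by simp
  define \<alpha> :: "real ^ 'k" where "\<alpha> = (\<chi> i. 1)"
  have \<alpha>: "\<alpha> \<in> positive_multiindices"
    by (simp add: \<alpha>_def positive_multiindices_def)
  have "convex hull E = scaled_hull x \<alpha>"
    by (simp add: scaled_hull_def E(2) \<alpha>_def)
  then have hull: "convex hull E = {(\<Sum>j\<in>UNIV. c j *\<^sub>R x j) | c. (\<Sum>j\<in>UNIV. \<bar>c j\<bar>) \<le> 1}"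
    unfolding scaled_hull_eq[OF \<alpha>] by (simp add: \<alpha>_def)
  obtain w where "w \<in> interior (convex hull E)"
    using E(1) unfolding direction_set_def by blast
  then obtain e where e: "0 < e" "cball w e \<subseteq> convex hull E"
    unfolding mem_interior_cball by blast
  have w: "w \<in> convex hull E"
    using e by auto
  have "\<exists>c. z = (\<Sum>j\<in>UNIV. c j *\<^sub>R x j) \<and> (\<Sum>j\<in>UNIV. \<bar>c j\<bar>) \<le> 2 / e * norm z" for z
  proof (cases "z = 0")
    case True
    then show ?thesis
      by (intro exI[of _ "\<lambda>_. 0"]) simp
  next
    case False
    define t where "t = norm z / e"
    have t: "0 < t"
      using False e(1) by (simp add: t_def)
    have "w + inverse t *\<^sub>R z \<in> cball w e"
      using False e(1) by (simp add: t_def dist_norm)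
    with e(2) have "w + inverse t *\<^sub>R z \<in> convex hull E"
      by blast
    then obtain c where c: "w + inverse t *\<^sub>R z = (\<Sum>j\<in>UNIV. c j *\<^sub>R x j)" "(\<Sum>j\<in>UNIV. \<bar>c j\<bar>) \<le> 1"
      unfolding hull by blast
    obtain d where d: "w = (\<Sum>j\<in>UNIV. d j *\<^sub>R x j)" "(\<Sum>j\<in>UNIV. \<bar>d j\<bar>) \<le> 1"
      using w unfolding hull by blast
    have "z = t *\<^sub>R ((w + inverse t *\<^sub>R z) - w)"
      using t by simp
    also have "\<dots> = t *\<^sub>R ((\<Sum>j\<in>UNIV. c j *\<^sub>R x j) - (\<Sum>j\<in>UNIV. d j *\<^sub>R x j))"
      by (simp only: c(1) d(1)[symmetric])
    also have "\<dots> = (\<Sum>j\<in>UNIV. (t * (c j - d j)) *\<^sub>R x j)"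
      by (simp add: scaleR_sum_right sum_subtractf[symmetric] scaleR_left_diff_distrib[symmetric])
    finally have z: "z = (\<Sum>j\<in>UNIV. (t * (c j - d j)) *\<^sub>R x j)" .
    have "(\<Sum>j\<in>UNIV. \<bar>t * (c j - d j)\<bar>) = t * (\<Sum>j\<in>UNIV. \<bar>c j - d j\<bar>)"
      using t by (simp add: abs_mult sum_distrib_left)
    also have "\<dots> \<le> t * (\<Sum>j\<in>UNIV. \<bar>c j\<bar> + \<bar>d j\<bar>)"
      using t by (intro mult_left_mono sum_mono abs_triangle_ineq4) auto
    also have "\<dots> \<le> t * 2"
      using t c(2) d(2) by (intro mult_left_mono) (auto simp: sum.distrib)
    finally have "(\<Sum>j\<in>UNIV. \<bar>t * (c j - d j)\<bar>) \<le> 2 / e * norm z"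
      by (simp add: t_def mult.commute)
    with z show ?thesis
      by (intro exI[of _ "\<lambda>j. t * (c j - d j)"] conjI)
  qed
  then have "spanning_directions x (2 / e)"
    using unit e(1) by (intro spanning_directions.intro) auto
  then show ?thesis
    using that by blast
qed

context spanning_directions
begin

abbreviation hilbert :: "real ^ 'k \<Rightarrow> real ^ 'k \<Rightarrow> real" where
  "hilbert \<equiv> \<lambda>\<alpha> \<beta>. ln ((MAX i. \<alpha> $ i / \<beta> $ i) / (MIN i. \<alpha> $ i / \<beta> $ i))"

lemma admissible_multiindices_positive: "admissible_multiindices x \<subseteq> positive_multiindices"
  by (auto simp: admissible_multiindices_def)

lemma admissible_multiindices_scale:
  assumes \<alpha>: "\<alpha> \<in> admissible_multiindices x" and t: "0 < t"
  shows "t *\<^sub>R \<alpha> \<in> admissible_multiindices x"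
  unfolding admissible_multiindices_iff
proof (intro conjI allI impI)
  show "t *\<^sub>R \<alpha> \<in> positive_multiindices"
    using assms admissible_multiindices_positive by (auto simp: positive_multiindices_def)
  fix i c assume "x i = (\<Sum>j\<in>UNIV. c j *\<^sub>R x j)"
  then have "\<alpha> $ i \<le> (\<Sum>j\<in>UNIV. \<bar>c j\<bar> * \<alpha> $ j)"
    using \<alpha> unfolding admissible_multiindices_iff by blast
  then have "t * \<alpha> $ i \<le> t * (\<Sum>j\<in>UNIV. \<bar>c j\<bar> * \<alpha> $ j)"
    using t by simp
  also have "\<dots> = (\<Sum>j\<in>UNIV. \<bar>c j\<bar> * (t *\<^sub>R \<alpha>) $ j)"
    by (simp add: sum_distrib_left mult_ac)
  finally show "(t *\<^sub>R \<alpha>) $ i \<le> (\<Sum>j\<in>UNIV. \<bar>c j\<bar> * (t *\<^sub>R \<alpha>) $ j)"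
    by simp
qed

lemma admissible_multiindices_limit:
  assumes b: "\<And>n. b n \<in> admissible_multiindices x"
    and lim: "b \<longlonglongrightarrow> \<beta>" and \<beta>: "\<beta> \<in> positive_multiindices"
  shows "\<beta> \<in> admissible_multiindices x"
  unfolding admissible_multiindices_iff
proof (intro conjI allI impI)
  show "\<beta> \<in> positive_multiindices" by (rule \<beta>)
  fix i c assume "x i = (\<Sum>j\<in>UNIV. c j *\<^sub>R x j)"
  then have le: "b n $ i \<le> (\<Sum>j\<in>UNIV. \<bar>c j\<bar> * b n $ j)" for n
    using b unfolding admissible_multiindices_iff by blast
  show "\<beta> $ i \<le> (\<Sum>j\<in>UNIV. \<bar>c j\<bar> * \<beta> $ j)"
  proof (rule LIMSEQ_le)
    show "(\<lambda>n. b n $ i) \<longlonglongrightarrow> \<beta> $ i" "(\<lambda>n. \<Sum>j\<in>UNIV. \<bar>c j\<bar> * b n $ j) \<longlonglongrightarrow> (\<Sum>j\<in>UNIV. \<bar>c j\<bar> * \<beta> $ j)"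
      by (intro tendsto_intros lim)+
    show "\<exists>N. \<forall>n\<ge>N. b n $ i \<le> (\<Sum>j\<in>UNIV. \<bar>c j\<bar> * b n $ j)"
      using le by blast
  qed
qed

text \<open>After normalising one coordinate to \<open>1\<close>, the logarithms of the coordinates of a Cauchy
  sequence converge, so the coordinates have positive limits; admissibility passes to them.\<close>

lemma hilbert_complete:
  assumes s: "\<And>n. s n \<in> admissible_multiindices x"
    and cauchy: "\<And>\<epsilon>. \<epsilon> > 0 \<Longrightarrow> \<exists>N. \<forall>m\<ge>N. \<forall>n\<ge>N. hilbert (s m) (s n) < \<epsilon>"
  shows "\<exists>\<beta>\<in>admissible_multiindices x. (\<lambda>n. hilbert (s n) \<beta>) \<longlonglongrightarrow> 0"
proof -
  interpret projective_distance positive_multiindices "($)" index_scaling hilbert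
    by (rule projective_distance_multiindices)
  fix i\<^sub>0 :: 'k
  define b where "b n = inverse (s n $ i\<^sub>0) *\<^sub>R s n" for n
  have s_pos: "s n \<in> positive_multiindices" for n
    using s admissible_multiindices_positive by blast
  have b: "b n \<in> admissible_multiindices x" for n
    unfolding b_def using s positive_multiindicesD[OF s_pos] by (intro admissible_multiindices_scale) auto
  then have b_pos: "b n \<in> positive_multiindices" for n
    using admissible_multiindices_positive by blast
  note pos = positive_multiindicesD[OF b_pos]
  have rel: "(s n, b n) \<in> index_scaling" for n
    using positive_multiindicesD[OF s_pos, of n i\<^sub>0] unfolding index_scaling_def b_def
    by (auto simp del: scaleR_cancel_right intro!: exI[of _ "inverse (s n $ i\<^sub>0)"])
  have one: "b n $ i\<^sub>0 = 1" for n
    using positive_multiindicesD[OF s_pos, of n i\<^sub>0] by (simp add: b_def)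
  have diff: "\<bar>ln (b m $ i) - ln (b n $ i)\<bar> \<le> hilbert (s m) (s n)" for i m n
  proof -
    have "\<bar>ln (b m $ i) - ln (b n $ i)\<bar> \<le> hilbert (b m) (b n)"
      by (rule log_diff_le_distance[OF b_pos b_pos one one pos pos])
    also have "\<dots> = hilbert (s m) (s n)"
      by (rule distance_congruent[OF s_pos s_pos rel rel])
    finally show ?thesis .
  qed
  have "Cauchy (\<lambda>n. ln (b n $ i))" for i
  proof (rule metric_CauchyI)
    fix \<epsilon> :: real assume "0 < \<epsilon>"
    then obtain N where N: "\<forall>m\<ge>N. \<forall>n\<ge>N. hilbert (s m) (s n) < \<epsilon>"
      using cauchy[of \<epsilon>] by blast
    have "dist (ln (b m $ i)) (ln (b n $ i)) < \<epsilon>" if "m \<ge> N" "n \<ge> N" for m n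
      unfolding dist_real_def using diff[of m i n] N that by (meson order_le_less_trans)
    then show "\<exists>N. \<forall>m\<ge>N. \<forall>n\<ge>N. dist (ln (b m $ i)) (ln (b n $ i)) < \<epsilon>"
      by blast
  qed
  then have "\<forall>i. \<exists>L. (\<lambda>n. ln (b n $ i)) \<longlonglongrightarrow> L"
    by (simp add: Cauchy_convergent_iff convergent_def)
  then obtain L where L: "\<And>i. (\<lambda>n. ln (b n $ i)) \<longlonglongrightarrow> L i"
    by metis
  define \<beta> :: "real ^ 'k" where "\<beta> = (\<chi> i. exp (L i))"
  have \<beta>_pos: "\<beta> \<in> positive_multiindices"
    by (simp add: \<beta>_def positive_multiindices_def)
  have "(\<lambda>n. exp (ln (b n $ i))) \<longlonglongrightarrow> exp (L i)" for i
    by (intro tendsto_exp L)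
  then have "b \<longlonglongrightarrow> \<beta>"
    using pos by (intro vec_tendstoI) (simp add: \<beta>_def)
  then have \<beta>: "\<beta> \<in> admissible_multiindices x"
    using b \<beta>_pos admissible_multiindices_limit by blast
  define e where "e n = (\<Sum>i\<in>UNIV. \<bar>ln (b n $ i) - L i\<bar>)" for n
  have "e \<longlonglongrightarrow> (\<Sum>i\<in>(UNIV :: 'k set). \<bar>L i - L i\<bar>)"
    unfolding e_def by (intro tendsto_intros L)
  then have e: "(\<lambda>n. 2 * e n) \<longlonglongrightarrow> 0"
    using tendsto_mult_right_zero by auto
  have bound: "hilbert (s n) \<beta> \<le> 2 * e n" for n
  proof -
    have "\<bar>ln (b n $ i) - ln (\<beta> $ i)\<bar> \<le> e n" for i
      unfolding e_def \<beta>_def by simp (intro member_le_sum; simp)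
    then have "hilbert (b n) \<beta> \<le> 2 * e n"
      using b_pos \<beta>_pos pos positive_multiindicesD[OF \<beta>_pos] by (intro distance_le_log_diff)
    moreover have "(\<beta>, \<beta>) \<in> index_scaling"
      using equiv_class_self[OF equiv_scaling UNIV_I] by blast
    ultimately show ?thesis
      using distance_congruent[OF s_pos \<beta>_pos rel, of \<beta> n] by simp
  qed
  have "(\<lambda>n. hilbert (s n) \<beta>) \<longlonglongrightarrow> 0"
  proof (rule tendsto_sandwich[OF _ _ tendsto_const e])
    show "\<forall>\<^sub>F n in sequentially. 0 \<le> hilbert (s n) \<beta>"
      using distance_nonneg[OF s_pos \<beta>_pos] by simp
    show "\<forall>\<^sub>F n in sequentially. hilbert (s n) \<beta> \<le> 2 * e n"
      using bound by simp
  qed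
  with \<beta> show ?thesis
    by blast
qed

text \<open>An inequality \<open>q \<le> u p\<close> between norms of this kind need only be tested on the directions, so
  the optimal constants do not change when the norms are restricted to the directions.
  There they are the constants that define the Hilbert metric.\<close>

lemma norm_distance_eq_hilbert:
  assumes p: "p \<in> norms_on (\<Union>i. {x i, - x i})" and q: "q \<in> norms_on (\<Union>i. {x i, - x i})"
  shows "ln (upper_const p q / lower_const p q) = hilbert (\<chi> i. p (x i)) (\<chi> i. q (x i))"
proof -
  have pn: "p \<in> equivalent_norms" and qn: "q \<in> equivalent_norms"
    using p q by (auto simp: norms_on_def)
  have x: "x i \<noteq> 0" for i
    using unit[of i] by auto
  have pos: "0 < p (x i)" "0 < q (x i)" for i
    using equivalent_norms_pos pn qn x by blast+
  obtain i\<^sub>0 :: 'k where "x i\<^sub>0 \<noteq> 0"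
    using x by blast
  then have bounds: "optimal_ratio_bounds p q (lower_const p q) (upper_const p q)"
    by (rule optimal_ratio_bounds_norms[OF pn qn])
  note D = optimal_ratio_boundsD[OF bounds]
  have "optimal_ratio_bounds (\<lambda>i. p (x i)) (\<lambda>i. q (x i)) (lower_const p q) (upper_const p q)"
  proof (rule optimal_ratio_boundsI)
    show "l' \<le> lower_const p q" if le: "\<And>i. l' * p (x i) \<le> q (x i)" for l'
    proof (cases "0 < l'")
      case True
      have "p (x i) \<le> inverse l' * q (x i)" for i
        using le[of i] True by (simp add: field_simps)
      with True have "p z \<le> inverse l' * q z" for z
        by (rule norms_on_le[OF q pn less_imp_le[OF positive_imp_inverse_positive]])
      then show ?thesis
        using True by (intro D(5)) (simp add: field_simps)
    qed (use D(2) in linarith)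
    show "upper_const p q \<le> u'" if le: "\<And>i. q (x i) \<le> u' * p (x i)" for u'
    proof -
      have "0 < u' * p (x i\<^sub>0)"
        using le[of i\<^sub>0] pos(2)[of i\<^sub>0] by linarith
      then have "0 \<le> u'"
        using pos(1)[of i\<^sub>0] by (simp add: zero_less_mult_iff)
      then show ?thesis
        by (rule D(6)[OF norms_on_le[OF p qn _ le]])
    qed
  qed (use D(1-4) in auto)
  moreover have "optimal_ratio_bounds (\<lambda>i. q (x i)) (\<lambda>i. p (x i))
      (MIN i. p (x i) / q (x i)) (MAX i. p (x i) / q (x i))"
    using optimal_ratio_bounds_multiindices[of "\<chi> i. p (x i)" "\<chi> i. q (x i)"] pos
    by (simp add: positive_multiindices_def vec_lambda_inverse)
  ultimately have "lower_const p q = 1 / (MAX i. p (x i) / q (x i))"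
      "upper_const p q = 1 / (MIN i. p (x i) / q (x i))"
    using optimal_ratio_bounds_unique optimal_ratio_bounds_swap by blast+
  then show ?thesis
    by simp
qed

lemma norms_complete:
  assumes s: "\<And>n. s n \<in> norms_on (\<Union>i. {x i, - x i})"
    and cauchy: "\<And>\<epsilon>. \<epsilon> > 0 \<Longrightarrow>
      \<exists>N. \<forall>m\<ge>N. \<forall>n\<ge>N. ln (upper_const (s m) (s n) / lower_const (s m) (s n)) < \<epsilon>"
  shows "\<exists>p\<in>norms_on (\<Union>i. {x i, - x i}). (\<lambda>n. ln (upper_const (s n) p / lower_const (s n) p)) \<longlonglongrightarrow> 0"
proof -
  define a where "a n = (\<chi> i. s n (x i))" for n
  have a: "a n \<in> admissible_multiindices x" for n
    unfolding a_def using s by (intro norm_values_admissible) (auto simp: norms_on_def)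
  have "\<exists>N. \<forall>m\<ge>N. \<forall>n\<ge>N. hilbert (a m) (a n) < \<epsilon>" if "\<epsilon> > 0" for \<epsilon>
    using cauchy[OF that] unfolding norm_distance_eq_hilbert[OF s s] a_def .
  from hilbert_complete[OF a this]
  obtain \<beta> where \<beta>: "\<beta> \<in> admissible_multiindices x" "(\<lambda>n. hilbert (a n) \<beta>) \<longlonglongrightarrow> 0"
    by blast
  have g: "hull_gauge x \<beta> \<in> norms_on (\<Union>i. {x i, - x i})"
    using \<beta>(1) admissible_multiindices_positive by (intro hull_gauge_norms_on) blast
  have "(\<chi> i. hull_gauge x \<beta> (x i)) = \<beta>"
    by (simp add: vec_eq_iff hull_gauge_direction[OF \<beta>(1)])
  then have distance: "ln (upper_const (s n) (hull_gauge x \<beta>) / lower_const (s n) (hull_gauge x \<beta>)) = hilbert (a n) \<beta>" for n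
    by (simp only: norm_distance_eq_hilbert[OF s g] a_def)
  show ?thesis
    using \<beta>(2) unfolding distance[symmetric] by (rule bexI[OF _ g])
qed

end

theorem theorem6p2:
  fixes E :: "'a::banach set" and x :: "'k::finite \<Rightarrow> 'a"
  assumes "\<exists>B::'a set. finite B \<and> span B = UNIV"
    and "direction_set E"
    and "card E = 2 * CARD('k)"
    and "E = (\<Union>i. {x i, - x i})"
  shows "Metric_space (admissible_classes x) hilbert_metric \<and>
         Metric_space.mcomplete (admissible_classes x) hilbert_metric \<and>
         Metric_space (norm_classes E) norm_metric \<and>
         Metric_space.mcomplete (norm_classes E) norm_metric"
proof -
  obtain K where "spanning_directions x K"
    using direction_set_spanning[OF assms(2,4)] .
  then interpret spanning_directions x K .
  fix i\<^sub>0 :: 'k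
  have "x i\<^sub>0 \<noteq> 0"
    using unit[of i\<^sub>0] by auto
  then interpret N: projective_distance "equivalent_norms :: ('a \<Rightarrow> real) set" "\<lambda>p. p" norm_scaling
      "\<lambda>p q. ln (upper_const p q / lower_const p q)"
    by (rule projective_distance_norms)
  interpret R: projective_distance positive_multiindices "($)" index_scaling hilbert
    by (rule projective_distance_multiindices)
  have N: "norms_on E \<subseteq> equivalent_norms"
    by (auto simp: norms_on_def)
  show ?thesis
    unfolding admissible_classes_def hilbert_metric_def norm_classes_def norm_metric_def
  proof (intro conjI)
    show "Metric_space (admissible_multiindices x // index_scaling)
        (class_dist positive_multiindices index_scaling hilbert)"
      by (rule R.Metric_space_classes[OF admissible_multiindices_positive])
    show "Metric_space.mcomplete (admissible_multiindices x // index_scaling)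
        (class_dist positive_multiindices index_scaling hilbert)"
      by (rule R.mcomplete_classes[OF admissible_multiindices_positive hilbert_complete])
    show "Metric_space (norms_on E // norm_scaling)
        (class_dist equivalent_norms norm_scaling (\<lambda>p q. ln (upper_const p q / lower_const p q)))"
      by (rule N.Metric_space_classes[OF N])
    show "Metric_space.mcomplete (norms_on E // norm_scaling)
        (class_dist equivalent_norms norm_scaling (\<lambda>p q. ln (upper_const p q / lower_const p q)))"
      using N unfolding assms(4) by (rule N.mcomplete_classes[OF _ norms_complete])
  qed
qed

end
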